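(* There is a universal constant $\gamma>0$ such that for infinitely many values $n\in\mathbb{N}$ there is a contraction $A\in\mathbb{M}_n$ satisfying $$\|B\|_2\leq \gamma\,\|[A,B]\|_2$$ for every self-adjoint matrix $B\in\mathbb{M}_n$ of trace zero.
   Context: $\mathbb{M}_n$ denotes the complex $n\times n$ matrices. $[A,B]=AB-BA$ is the commutator. $\|B\|_2=\operatorname{tr}(B^*B)^{1/2}$ is the (unnormalized) Hilbert--Schmidt norm, with $\operatorname{tr}$ the usual matrix trace. A contraction is a matrix of operator norm (largest singular value) at most $1$. *)

theory Defs
  imports Complex_Main "Jordan_Normal_Form.Schur_Decomposition"
begin

definition mat_trace :: "'a :: comm_monoid_add mat \<Rightarrow> 'a" where
  "mat_trace A = (\<Sum>i<dim_row A. A $$ (i, i))"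

definition mat_commutator :: "'a :: ring mat \<Rightarrow> 'a mat \<Rightarrow> 'a mat" where
  "mat_commutator A B = A * B - B * A"

definition self_adjoint_mat :: "complex mat \<Rightarrow> bool" where
  "self_adjoint_mat B \<longleftrightarrow> mat_adjoint B = B"

text \<open>The trace below is a nonnegative real number, so taking its real part loses nothing.\<close>

definition hs_norm :: "complex mat \<Rightarrow> real" where
  "hs_norm B = sqrt (Re (mat_trace (mat_adjoint B * B)))"

text \<open>Likewise \<open>v \<bullet>c v\<close> is the sum of the \<open>\<bar>v\<^sub>i\<bar>\<^sup>2\<close>.\<close>

definition l2_norm_vec :: "complex vec \<Rightarrow> real" where
  "l2_norm_vec v = sqrt (Re (v \<bullet>c v))"

lemma l2_norm_vec_altdef: "l2_norm_vec v = sqrt (\<Sum>i<dim_vec v. (cmod (v $ i))\<^sup>2)"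
  unfolding l2_norm_vec_def scalar_prod_def
  by (auto simp: complex_mult_cnj cmod_power2 lessThan_atLeast0 intro!: sum.cong)

definition op_norm_mat :: "complex mat \<Rightarrow> real" where
  "op_norm_mat A = (SUP v \<in> {v \<in> carrier_vec (dim_col A). l2_norm_vec v \<le> 1}. l2_norm_vec (A *\<^sub>v v))"

definition contraction_mat :: "complex mat \<Rightarrow> bool" where
  "contraction_mat A \<longleftrightarrow> op_norm_mat A \<le> 1"

text \<open>The supremum defining \<^const>\<open>op_norm_mat\<close> is over a set bounded above, so it is a genuine one.\<close>

lemma bdd_above_op_norm_mat:
  "bdd_above ((\<lambda>v. l2_norm_vec (A *\<^sub>v v)) ` {v \<in> carrier_vec (dim_col A). l2_norm_vec v \<le> 1})"
proof (rule bdd_aboveI2)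
  fix v :: "complex vec"
  assume "v \<in> {v \<in> carrier_vec (dim_col A). l2_norm_vec v \<le> 1}"
  then have v: "dim_vec v = dim_col A" and v1: "(\<Sum>j<dim_col A. (cmod (v $ j))\<^sup>2) \<le> 1"
    by (auto simp: l2_norm_vec_altdef)
  have vj: "cmod (v $ j) \<le> 1" if "j < dim_col A" for j
  proof -
    have "(cmod (v $ j))\<^sup>2 \<le> (\<Sum>j<dim_col A. (cmod (v $ j))\<^sup>2)"
      using that by (intro member_le_sum) auto
    with v1 have "(cmod (v $ j))\<^sup>2 \<le> 1" by linarith
    then show ?thesis by (simp add: abs_square_le_1)
  qed
  have Avi: "cmod ((A *\<^sub>v v) $ i) \<le> (\<Sum>j<dim_col A. cmod (A $$ (i, j)))" if "i < dim_row A" for i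
  proof -
    have "(A *\<^sub>v v) $ i = (\<Sum>j<dim_col A. A $$ (i, j) * v $ j)"
      using that v by (simp add: scalar_prod_def lessThan_atLeast0)
    also have "cmod \<dots> \<le> (\<Sum>j<dim_col A. cmod (A $$ (i, j) * v $ j))"
      by (rule norm_sum)
    also have "\<dots> \<le> (\<Sum>j<dim_col A. cmod (A $$ (i, j)))"
      using vj by (intro sum_mono) (auto simp: norm_mult intro!: mult_left_le)
    finally show ?thesis .
  qed
  show "l2_norm_vec (A *\<^sub>v v) \<le> sqrt (\<Sum>i<dim_row A. (\<Sum>j<dim_col A. cmod (A $$ (i, j)))\<^sup>2)"
    unfolding l2_norm_vec_altdef using Avi by (auto intro!: real_sqrt_le_mono sum_mono power_mono)
qed

end

theory Submission
  imports Defs "HOL-Analysis.L2_Norm" "HOL-Library.Real_Mod"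
begin

text \<open>
  Write \<open>A = (X + i Y) / 32\<close> with \<open>X\<close> and \<open>Y\<close> Hermitian; for Hermitian \<open>B\<close> a small \<open>[A, B]\<close> forces
  both \<open>[X, B]\<close> and \<open>[Y, B]\<close> to be small. The matrices have \<open>4 \<times> 4\<close> blocks of odd size \<open>N\<close>. The
  diagonal matrix \<open>X\<close> has well separated values on different blocks, so \<open>B\<close> is nearly block
  diagonal, and inside a block it is a slowly increasing clock. The off-diagonal unitary blocks of
  \<open>Y\<close> force the diagonal blocks of \<open>B\<close> to be close to each other and to nearly commute with a
  quadratic phase and with the discrete Fourier transform.

  Expand a diagonal block in the Weyl basis of \<open>M\<^sub>N\<close>, indexed by \<open>(\<int>/N)\<^sup>2\<close>. Up to phases, conjugation
  by these two unitaries permutes the coefficients by the shear \<open>(a, c) \<mapsto> (a + c, c)\<close> and the rotation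
  \<open>(a, c) \<mapsto> (c, -a)\<close>. So the absolute values of the coefficients are a nearly invariant function,
  concentrated near the origin by the clock, where \<open>SL\<^sub>2(\<int>)\<close> acts without wrap-around. The ping-pong
  partition of \<open>\<int>\<^sup>2 - {0}\<close> under two opposite shears leaves only mass at the origin, which is the
  trace of the block; and all traces nearly agree and sum to zero.
\<close>

section \<open>The ping-pong estimate\<close>

lemma L2_set_subset: "finite B \<Longrightarrow> A \<subseteq> B \<Longrightarrow> L2_set f A \<le> L2_set f B"
  unfolding L2_set_def by (intro real_sqrt_le_mono sum_mono2) auto

lemma L2_set_reindex: "inj_on h A \<Longrightarrow> L2_set f (h ` A) = L2_set (\<lambda>x. f (h x)) A"
  unfolding L2_set_def by (simp add: sum.reindex)

lemma L2_set_Un_disjoint: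
  "finite A \<Longrightarrow> finite B \<Longrightarrow> A \<inter> B = {} \<Longrightarrow> (L2_set f (A \<union> B))\<^sup>2 = (L2_set f A)\<^sup>2 + (L2_set f B)\<^sup>2"
  unfolding L2_set_def by (simp add: sum_nonneg sum.union_disjoint)

lemma L2_set_Un_le:
  assumes "finite A" "finite B"
  shows "L2_set f (A \<union> B) \<le> L2_set f A + L2_set f B"
proof (rule power2_le_imp_le)
  have "(L2_set f (A \<union> B))\<^sup>2 = (L2_set f A)\<^sup>2 + (L2_set f (B - A))\<^sup>2"
    using L2_set_Un_disjoint[of A "B - A" f] assms by simp
  also have "\<dots> \<le> (L2_set f A)\<^sup>2 + (L2_set f B)\<^sup>2"
    using assms by (intro add_left_mono power_mono L2_set_subset) auto
  also have "\<dots> \<le> (L2_set f A + L2_set f B)\<^sup>2"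
    by (simp add: power2_sum)
  finally show "(L2_set f (A \<union> B))\<^sup>2 \<le> (L2_set f A + L2_set f B)\<^sup>2" .
qed simp

text \<open>Used for \<open>g\<close> nearly invariant under \<open>\<phi>\<close>: moving a set
  changes its mass by at most the invariance defect. \<open>L2_set_image_le\<close> is the opposite
  direction.\<close>

lemma L2_set_image_ge:
  assumes "inj_on \<phi> S" and "L2_set (\<lambda>s. g (\<phi> s) - g s) S \<le> \<epsilon>"
  shows "L2_set g S \<le> L2_set g (\<phi> ` S) + \<epsilon>"
proof -
  have "L2_set g S = L2_set (\<lambda>s. g (\<phi> s) + (g s - g (\<phi> s))) S" by simp
  also have "\<dots> \<le> L2_set (\<lambda>s. g (\<phi> s)) S + L2_set (\<lambda>s. g s - g (\<phi> s)) S"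
    by (rule L2_set_triangle_ineq)
  also have "L2_set (\<lambda>s. g s - g (\<phi> s)) S = L2_set (\<lambda>s. g (\<phi> s) - g s) S"
    unfolding L2_set_def by (simp add: power2_commute)
  finally show ?thesis using assms by (simp add: L2_set_reindex)
qed

lemma L2_set_image_le:
  assumes "inj_on \<phi> S" and "L2_set (\<lambda>s. g (\<phi> s) - g s) S \<le> \<epsilon>"
  shows "L2_set g (\<phi> ` S) \<le> L2_set g S + \<epsilon>"
proof -
  have "L2_set g (\<phi> ` S) = L2_set (\<lambda>s. g s + (g (\<phi> s) - g s)) S"
    using assms by (simp add: L2_set_reindex)
  also have "\<dots> \<le> L2_set g S + L2_set (\<lambda>s. g (\<phi> s) - g s) S"
    by (rule L2_set_triangle_ineq)
  finally show ?thesis using assms by simp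
qed

lemma L2_set_cmod_sum: "L2_set (\<lambda>x. cmod (\<Sum>i\<in>I. f i x)) S \<le> (\<Sum>i\<in>I. L2_set (\<lambda>x. cmod (f i x)) S)"
proof (induction I rule: infinite_finite_induct)
  case (insert i I)
  have "L2_set (\<lambda>x. cmod (\<Sum>i\<in>insert i I. f i x)) S \<le> L2_set (\<lambda>x. cmod (f i x) + cmod (\<Sum>i\<in>I. f i x)) S"
    using insert(1,2) by (intro L2_set_mono) (auto intro: norm_triangle_ineq)
  also have "\<dots> \<le> L2_set (\<lambda>x. cmod (f i x)) S + L2_set (\<lambda>x. cmod (\<Sum>i\<in>I. f i x)) S"
    by (rule L2_set_triangle_ineq)
  finally show ?case using insert by simp
qed (simp_all add: L2_set_def)

text \<open>Shearing the quadrant pair \<open>Q\<close> horizontally and vertically gives two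
  disjoint sets inside \<open>P\<close>, each carrying nearly the mass of \<open>Q\<close>, while
  \<open>P\<close> carries hardly more than \<open>Q\<close>. Squared masses add over disjoint sets,
  so the mass of \<open>Q\<close> must be of order \<open>\<epsilon>\<close>. The window has radius
  \<open>2 * k\<close> so that a shear of a point with coordinates of size at most \<open>k\<close>
  stays inside it.\<close>

lemma ping_pong:
  fixes g :: "int \<times> int \<Rightarrow> real" and k :: int
  defines "R \<equiv> {-2*k..2*k}"
  assumes shear: "L2_set (\<lambda>(a,c). g (a + c, c) - g (a, c)) {(a,c) \<in> R \<times> R. a + c \<in> R} \<le> \<epsilon>"
    and rot: "L2_set (\<lambda>(a,c). g (c, -a) - g (a, c)) (R \<times> R) \<le> \<epsilon>"
    and outer: "L2_set g {(a,c) \<in> R \<times> R. \<bar>c\<bar> > k} \<le> \<epsilon>"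
    and k: "k \<ge> 0"
  shows "L2_set g (R \<times> R - {(0,0)}) \<le> 43 * \<epsilon>"
proof -
  define T where "T = (\<lambda>(a::int,c::int). (a + c, c))"
  define T' where "T' = (\<lambda>(a::int,c::int). (a - c, c))"
  define J where "J = (\<lambda>(a::int,c::int). (c, -a))"
  define J' where "J' = (\<lambda>(a::int,c::int). (-c, a))"
  \<comment> \<open>The quadrants are half-open: \<open>P\<close> and its quarter turn partition the
    nonzero points, and \<open>a \<noteq> 0\<close> on \<open>P\<close> keeps the two sheared images
    below apart.\<close>
  define P where "P = {(a,c) \<in> R \<times> R. a > 0 \<and> c \<ge> 0 \<or> a < 0 \<and> c \<le> 0}"
  define Q where "Q = {(a,c) \<in> P. \<bar>a\<bar> \<le> k \<and> \<bar>c\<bar> \<le> k}"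
  define Oc where "Oc = {(a,c) \<in> R \<times> R. \<bar>c\<bar> > k}"
  define Oa where "Oa = {(a,c) \<in> R \<times> R. \<bar>a\<bar> > k}"
  have finR: "finite (R \<times> R)" by (simp add: R_def)
  have fin: "finite P" "finite Q" "finite Oc" "finite Oa"
    by (rule finite_subset[OF _ finR]; auto simp: P_def Q_def Oc_def Oa_def)+
  have inj: "inj_on T S" "inj_on T' S" "inj_on J S" "inj_on J' S" for S
    by (auto simp: inj_on_def T_def T'_def J_def J'_def)
  have TS: "L2_set (\<lambda>s. g (T s) - g s) S \<le> \<epsilon>" if "S \<subseteq> R \<times> R" "T ` S \<subseteq> R \<times> R" for S
  proof -
    have "L2_set (\<lambda>s. g (T s) - g s) S \<le> L2_set (\<lambda>s. g (T s) - g s) {(a,c) \<in> R \<times> R. a + c \<in> R}"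
      using that by (intro L2_set_subset finite_subset[OF _ finR]) (auto simp: T_def)
    with shear show ?thesis by (simp add: T_def case_prod_unfold)
  qed
  have JS: "L2_set (\<lambda>s. g (J s) - g s) S \<le> \<epsilon>" if "S \<subseteq> R \<times> R" for S
  proof -
    have "L2_set (\<lambda>s. g (J s) - g s) S \<le> L2_set (\<lambda>s. g (J s) - g s) (R \<times> R)"
      using that finR by (intro L2_set_subset)
    with rot show ?thesis by (simp add: J_def case_prod_unfold)
  qed
  define p where "p = L2_set g Q"
  have e0: "\<epsilon> \<ge> 0" using outer L2_set_nonneg order_trans by blast
  have oc: "L2_set g Oc \<le> \<epsilon>" using outer by (simp add: Oc_def)
  \<comment> \<open>The hypothesis controls large \<open>c\<close> only; the quarter turn carries
    large \<open>a\<close> there, at the cost of one more \<open>\<epsilon>\<close>.\<close>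
  have "J ` Oa \<subseteq> Oc" "Oa \<subseteq> R \<times> R" by (auto simp: J_def Oa_def Oc_def R_def)
  then have oa: "L2_set g Oa \<le> 2 * \<epsilon>"
    using L2_set_image_ge[OF inj(3) JS, of Oa] L2_set_subset[OF fin(3), of "J ` Oa" g] oc by simp
  have "L2_set g P \<le> L2_set g (Q \<union> (Oc \<union> Oa))"
    using fin by (intro L2_set_subset) (auto simp: P_def Q_def Oc_def Oa_def)
  also have "\<dots> \<le> L2_set g Q + (L2_set g Oc + L2_set g Oa)"
    using fin by (intro order_trans[OF L2_set_Un_le] add_left_mono L2_set_Un_le) auto
  finally have P_le: "L2_set g P \<le> p + 3 * \<epsilon>" using oc oa by (simp add: p_def)
  define U where "U = T ` Q"
  have "T ` Q \<subseteq> R \<times> R" "Q \<subseteq> R \<times> R"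
    by (auto simp: T_def Q_def P_def R_def)
  then have pU: "p \<le> L2_set g U + \<epsilon>"
    unfolding p_def U_def by (intro L2_set_image_ge inj TS)
  \<comment> \<open>The opposite shear \<open>(a, c) \<mapsto> (a, a + c)\<close> is \<open>J \<circ> T\<inverse> \<circ> J\<inverse>\<close>.\<close>
  define W1 where "W1 = J' ` Q"
  define W2 where "W2 = T' ` W1"
  define W where "W = J ` W2"
  have sub: "W1 \<subseteq> R \<times> R" "W2 \<subseteq> R \<times> R"
    by (auto simp: W1_def W2_def T'_def J'_def Q_def P_def R_def)
  have QW: "Q = J ` W1" "W1 = T ` W2"
    by (auto simp: W1_def W2_def image_image T_def T'_def J_def J'_def case_prod_unfold)
  \<comment> \<open>Near-invariance is given for \<open>T\<close> and \<open>J\<close> only, so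
    moves by their inverses are read backwards, as forward moves from \<open>W1\<close> to
    \<open>Q\<close> and from \<open>W2\<close> to \<open>W1\<close>.\<close>
  have "p \<le> L2_set g W1 + \<epsilon>"
    unfolding p_def QW(1) by (intro L2_set_image_le inj JS sub)
  moreover have "L2_set g W1 \<le> L2_set g W2 + \<epsilon>"
  proof -
    have "T ` W2 \<subseteq> R \<times> R" using sub(1) QW(2) by metis
    then show ?thesis using L2_set_image_le[OF inj(1) TS[OF sub(2)]] QW(2) by simp
  qed
  moreover have "L2_set g W2 \<le> L2_set g W + \<epsilon>"
    unfolding W_def by (intro L2_set_image_ge inj JS sub)
  ultimately have pW: "p \<le> L2_set g W + 3 * \<epsilon>" by simp
  \<comment> \<open>On \<open>U\<close> the first coordinate is strictly larger in absolute value,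
    on \<open>W\<close> the second is at least as large.\<close>
  have UW: "U \<inter> W = {}" "U \<union> W \<subseteq> P"
    by (auto simp: U_def W_def W1_def W2_def Q_def P_def T_def T'_def J_def J'_def R_def)
  have finUW: "finite U" "finite W"
    using UW(2) fin(1) finite_subset by auto
  have le: "(L2_set g U)\<^sup>2 + (L2_set g W)\<^sup>2 \<le> (p + 3 * \<epsilon>)\<^sup>2"
  proof -
    have "(L2_set g U)\<^sup>2 + (L2_set g W)\<^sup>2 = (L2_set g (U \<union> W))\<^sup>2"
      using UW finUW by (simp add: L2_set_Un_disjoint)
    also have "\<dots> \<le> (p + 3 * \<epsilon>)\<^sup>2"
      by (intro power_mono order_trans[OF L2_set_subset[OF fin(1) UW(2)] P_le]) simp
    finally show ?thesis .
  qed
  \<comment> \<open>For \<open>p = 18 * \<epsilon> + q\<close> both sheared sets have mass at least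
    \<open>15 * \<epsilon> + q\<close>, but \<open>P\<close> at most
    \<open>21 * \<epsilon> + q\<close>. The threshold works because
    \<open>2 * 15\<^sup>2 = 450\<close> exceeds \<open>21\<^sup>2 = 441\<close>.\<close>
  have p18: "p \<le> 18 * \<epsilon>"
  proof (rule ccontr)
    assume "\<not> p \<le> 18 * \<epsilon>"
    then obtain q where q: "p = 18 * \<epsilon> + q" "q > 0"
      by (metis add_diff_cancel_left' diff_add_cancel diff_gt_0_iff_gt not_le add.commute)
    have "(15 * \<epsilon> + q)\<^sup>2 \<le> (L2_set g U)\<^sup>2" "(15 * \<epsilon> + q)\<^sup>2 \<le> (L2_set g W)\<^sup>2"
      using pU pW q e0 by (auto intro!: power_mono)
    with le have "2 * (15 * \<epsilon> + q)\<^sup>2 \<le> (21 * \<epsilon> + q)\<^sup>2" by (simp add: q)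
    then have "9 * \<epsilon>\<^sup>2 + 18 * (\<epsilon> * q) + q\<^sup>2 \<le> 0"
      by (simp add: power2_sum power_mult_distrib algebra_simps)
    moreover have "q\<^sup>2 > 0" "\<epsilon> * q \<ge> 0" "\<epsilon>\<^sup>2 \<ge> 0" using q e0 by auto
    ultimately show False by linarith
  qed
  \<comment> \<open>\<open>P\<close> has mass at most \<open>21 * \<epsilon>\<close> and its quarter
    turn at most \<open>22 * \<epsilon>\<close>, which gives 43.\<close>
  have "R \<times> R - {(0,0)} \<subseteq> P \<union> J ` P"
  proof
    fix p assume p: "p \<in> R \<times> R - {(0,0)}"
    obtain a c where ac: "p = (a, c)" by fastforce
    have "p \<in> P \<or> (-c, a) \<in> P" using p by (auto simp: P_def R_def ac)
    moreover have "p = J (-c, a)" by (simp add: J_def ac)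
    ultimately show "p \<in> P \<union> J ` P" by blast
  qed
  then have "L2_set g (R \<times> R - {(0,0)}) \<le> L2_set g P + L2_set g (J ` P)"
    using fin by (intro order_trans[OF L2_set_subset L2_set_Un_le]) auto
  moreover have "P \<subseteq> R \<times> R" by (auto simp: P_def)
  then have "L2_set g (J ` P) \<le> L2_set g P + \<epsilon>" by (intro L2_set_image_le inj JS)
  ultimately show ?thesis using P_le p18 by simp
qed

section \<open>Characters modulo \<open>N\<close>\<close>

text \<open>Functions on the residues modulo \<open>N\<close> are kept as functions on the integers,
  so that indices such as \<open>x + c\<close> or \<open>-a\<close> can be written without
  reduction.\<close>

definition periodic :: "nat \<Rightarrow> (int \<Rightarrow> 'a) \<Rightarrow> bool" where
  "periodic N h \<longleftrightarrow> (\<forall>x. h (x mod int N) = h x)"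

definition biperiodic :: "nat \<Rightarrow> (int \<Rightarrow> int \<Rightarrow> 'a) \<Rightarrow> bool" where
  "biperiodic N b \<longleftrightarrow> (\<forall>x y. b (x mod int N) (y mod int N) = b x y)"

definition e_char :: "nat \<Rightarrow> int \<Rightarrow> complex" where
  "e_char N t = cis (2 * pi * real_of_int t / real N)"

lemma e_char_add: "e_char N (s + t) = e_char N s * e_char N t"
  by (simp add: e_char_def cis_mult ring_distribs add_divide_distrib)

lemma e_char_0 [simp]: "e_char N 0 = 1"
  by (simp add: e_char_def)

lemma cmod_e_char [simp]: "cmod (e_char N t) = 1"
  by (simp add: e_char_def)

lemma cnj_e_char [simp]: "cnj (e_char N t) = e_char N (- t)"
  by (simp add: e_char_def cis_cnj)

lemma e_char_mult_uminus: "e_char N t * e_char N (-t) = 1"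
  by (simp flip: e_char_add)

lemma mod_interval_bij:
  assumes "N > 0"
  shows "bij_betw (\<lambda>x. x mod int N) {s..<s + int N} {0..<int N}"
proof (rule bij_betw_imageI)
  show "inj_on (\<lambda>x. x mod int N) {s..<s + int N}"
  proof (rule inj_onI)
    fix x y assume xy: "x \<in> {s..<s + int N}" "y \<in> {s..<s + int N}" "x mod int N = y mod int N"
    then have "int N dvd x - y" by (simp add: mod_eq_dvd_iff)
    moreover have "\<bar>x - y\<bar> < int N" using xy by auto
    ultimately show "x = y" using zdvd_not_zless by (metis dvd_abs_iff eq_iff_diff_eq_0 zero_less_abs_iff)
  qed
  show "(\<lambda>x. x mod int N) ` {s..<s + int N} = {0..<int N}"
  proof (intro equalityI subsetI)
    fix y assume y: "y \<in> {0..<int N}"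
    have 1: "s + (y - s) mod int N \<in> {s..<s + int N}" using assms by simp
    have 2: "(s + (y - s) mod int N) mod int N = y"
      using y by (simp add: mod_add_right_eq)
    show "y \<in> (\<lambda>x. x mod int N) ` {s..<s + int N}"
      using image_eqI[of y "\<lambda>x. x mod int N", OF 2[symmetric] 1] .
  qed (use assms in auto)
qed

lemma sum_periodic_interval:
  assumes "N > 0" "periodic N h"
  shows "(\<Sum>x\<in>{s..<s + int N}. h x) = (\<Sum>x\<in>{0..<int N}. h x)"
proof -
  have "(\<Sum>x\<in>{s..<s + int N}. h x) = (\<Sum>x\<in>{s..<s + int N}. h (x mod int N))"
    using assms by (simp add: periodic_def)
  also have "\<dots> = (\<Sum>x\<in>{0..<int N}. h x)"
    by (rule sum.reindex_bij_betw[OF mod_interval_bij[OF assms(1)]])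
  finally show ?thesis .
qed

lemma sum_periodic_shift:
  assumes "N > 0" "periodic N h"
  shows "(\<Sum>x\<in>{s..<s + int N}. h (c + x)) = (\<Sum>x\<in>{0..<int N}. h x)"
proof -
  have "bij_betw ((+) c) {s..<s + int N} {c + s..<(c + s) + int N}"
    using bij_betw_add[of c "{s..<s + int N}"] by (simp add: ac_simps)
  then have "(\<Sum>x\<in>{s..<s + int N}. h (c + x)) = (\<Sum>x\<in>{c + s..<(c + s) + int N}. h x)"
    by (rule sum.reindex_bij_betw)
  then show ?thesis using sum_periodic_interval[OF assms] by simp
qed

lemma e_char_eq_1_iff:
  assumes "N > 0"
  shows "e_char N t = 1 \<longleftrightarrow> int N dvd t"
proof -
  have "e_char N t = 1 \<longleftrightarrow> (\<exists>k. 2 * pi * real_of_int t / real N = real_of_int k * (2 * pi))"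
    by (simp add: e_char_def cis_eq_1_iff)
  also have "\<dots> \<longleftrightarrow> (\<exists>k. real_of_int t = real_of_int (int N * k))"
    using assms by (intro ex_cong1) (auto simp: field_simps)
  also have "\<dots> \<longleftrightarrow> int N dvd t" by (simp only: of_int_eq_iff dvd_def)
  finally show ?thesis .
qed

lemma e_char_cong:
  assumes "N > 0" "int N dvd s - t"
  shows "e_char N s = e_char N t"
proof -
  have "e_char N s = e_char N (s - t) * e_char N t" by (simp flip: e_char_add)
  then show ?thesis using e_char_eq_1_iff[OF assms(1)] assms(2) by simp
qed

lemma periodic_e_char:
  assumes "N > 0"
  shows "periodic N (\<lambda>x. e_char N (t * x))"
  unfolding periodic_def
proof
  fix x
  have "int N dvd t * (x mod int N - x)" by (intro dvd_mult) (simp add: mod_eq_dvd_iff[symmetric])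
  then show "e_char N (t * (x mod int N)) = e_char N (t * x)"
    by (intro e_char_cong[OF assms]) (simp add: right_diff_distrib)
qed

text \<open>When \<open>N\<close> does not divide \<open>t\<close>, shifting the summation variable
  by 1 multiplies the sum by \<open>e_char N t\<close>, which differs from 1.\<close>

lemma sum_e_char:
  assumes "N > 0"
  shows "(\<Sum>x\<in>{0..<int N}. e_char N (t * x)) = (if int N dvd t then of_nat N else 0)"
proof (cases "int N dvd t")
  case True
  then have "e_char N (t * x) = 1" for x by (simp add: e_char_eq_1_iff[OF assms])
  then show ?thesis using True by simp
next
  case False
  let ?S = "\<Sum>x\<in>{0..<int N}. e_char N (t * x)"
  have "?S = (\<Sum>x\<in>{0..<int N}. e_char N (t * (1 + x)))"
    using sum_periodic_shift[OF assms periodic_e_char[OF assms], of t 1 0] by simp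
  also have "\<dots> = e_char N t * ?S"
    by (simp add: ring_distribs e_char_add sum_distrib_left)
  finally have "?S = 0" using False e_char_eq_1_iff[OF assms] by simp
  then show ?thesis using False by simp
qed

text \<open>Expanding the squares and summing over \<open>a\<close> first leaves only
  \<open>x = y\<close>, by orthogonality of characters. The frequency window may start anywhere,
  because ping-pong uses the symmetric window from \<open>-2 * k\<close> to
  \<open>2 * k\<close>.\<close>

lemma fourier_parseval:
  assumes "N > 0"
  shows "(\<Sum>a\<in>{s..<s + int N}. (cmod (\<Sum>x\<in>{0..<int N}. h x * e_char N (-(a * x))))\<^sup>2)
       = real N * (\<Sum>x\<in>{0..<int N}. (cmod (h x))\<^sup>2)"
proof -
  let ?Z = "{0..<int N}"
  define F where "F a = (\<Sum>x\<in>?Z. h x * e_char N (-(a * x)))" for a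
  have "periodic N F"
    using periodic_e_char[OF assms] unfolding periodic_def F_def
    by (intro allI sum.cong refl) (metis mult.commute mult_minus_left)
  then have "periodic N (\<lambda>a. (cmod (F a))\<^sup>2)"
    by (simp add: periodic_def)
  then have "(\<Sum>a\<in>{s..<s + int N}. (cmod (F a))\<^sup>2) = (\<Sum>a\<in>?Z. (cmod (F a))\<^sup>2)"
    by (rule sum_periodic_interval[OF assms])
  moreover have "complex_of_real (\<Sum>a\<in>?Z. (cmod (F a))\<^sup>2)
     = complex_of_real (real N * (\<Sum>x\<in>?Z. (cmod (h x))\<^sup>2))"
  proof -
    have "complex_of_real (\<Sum>a\<in>?Z. (cmod (F a))\<^sup>2) = (\<Sum>a\<in>?Z. F a * cnj (F a))"
      by (simp add: complex_norm_square del: of_real_power)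
    also have "\<dots> = (\<Sum>a\<in>?Z. \<Sum>x\<in>?Z. \<Sum>y\<in>?Z. h x * cnj (h y) * e_char N ((y - x) * a))"
      by (simp add: F_def sum_product algebra_simps e_char_add diff_conv_add_uminus del: add_uminus_conv_diff)
    also have "\<dots> = (\<Sum>x\<in>?Z. \<Sum>a\<in>?Z. \<Sum>y\<in>?Z. h x * cnj (h y) * e_char N ((y - x) * a))"
      by (rule sum.swap)
    also have "\<dots> = (\<Sum>x\<in>?Z. \<Sum>y\<in>?Z. \<Sum>a\<in>?Z. h x * cnj (h y) * e_char N ((y - x) * a))"
      by (intro sum.cong refl sum.swap)
    also have "\<dots> = (\<Sum>x\<in>?Z. \<Sum>y\<in>?Z. h x * cnj (h y) * (if int N dvd y - x then of_nat N else 0))"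
      by (simp add: sum_distrib_left[symmetric] sum_e_char[OF assms])
    also have "\<dots> = (\<Sum>x\<in>?Z. \<Sum>y\<in>?Z. if x = y then h x * cnj (h y) * of_nat N else 0)"
    proof (intro sum.cong refl)
      fix x y assume xy: "x \<in> ?Z" "y \<in> ?Z"
      then have "int N dvd y - x \<longleftrightarrow> x = y"
        by (metis atLeastLessThan_iff mod_eq_dvd_iff mod_pos_pos_trivial)
      then show "h x * cnj (h y) * (if int N dvd y - x then of_nat N else 0)
          = (if x = y then h x * cnj (h y) * of_nat N else 0)" by simp
    qed
    also have "\<dots> = (\<Sum>x\<in>?Z. h x * cnj (h x) * of_nat N)"
      by simp
    also have "\<dots> = complex_of_real (real N * (\<Sum>x\<in>?Z. (cmod (h x))\<^sup>2))"
      by (simp add: sum_distrib_left complex_norm_square mult.commute del: of_real_power)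
    finally show ?thesis .
  qed
  ultimately show ?thesis
    unfolding F_def of_real_eq_iff by simp
qed

section \<open>Weyl coefficients\<close>

definition hs_int :: "nat \<Rightarrow> (int \<Rightarrow> int \<Rightarrow> complex) \<Rightarrow> real" where
  "hs_int N b = L2_set (\<lambda>(x,y). cmod (b x y)) ({0..<int N} \<times> {0..<int N})"

lemma hs_int_triangle: "hs_int N (\<lambda>x y. f x y + g x y) \<le> hs_int N f + hs_int N g"
proof -
  have "hs_int N (\<lambda>x y. f x y + g x y)
     \<le> L2_set (\<lambda>p. (case p of (x,y) \<Rightarrow> cmod (f x y)) + (case p of (x,y) \<Rightarrow> cmod (g x y))) ({0..<int N} \<times> {0..<int N})"
    unfolding hs_int_def by (intro L2_set_mono) (auto intro: norm_triangle_ineq)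
  also have "\<dots> \<le> hs_int N f + hs_int N g"
    unfolding hs_int_def by (rule L2_set_triangle_ineq)
  finally show ?thesis .
qed

lemma hs_int_diff_commute: "hs_int N (\<lambda>x y. f x y - g x y) = hs_int N (\<lambda>x y. g x y - f x y)"
  by (simp add: hs_int_def norm_minus_commute)

lemma hs_int_cong: "(\<And>x y. x \<in> {0..<int N} \<Longrightarrow> y \<in> {0..<int N} \<Longrightarrow> f x y = g x y) \<Longrightarrow> hs_int N f = hs_int N g"
  unfolding hs_int_def by (intro L2_set_cong) auto

lemma hs_int_mono: "(\<And>x y. x \<in> {0..<int N} \<Longrightarrow> y \<in> {0..<int N} \<Longrightarrow> cmod (f x y) \<le> cmod (g x y)) \<Longrightarrow> hs_int N f \<le> hs_int N g"
  unfolding hs_int_def by (intro L2_set_mono) auto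

lemma hs_int_nonneg [simp]: "hs_int N f \<ge> 0"
  by (simp add: hs_int_def)

lemma hs_int_uminus [simp]: "hs_int N (\<lambda>x y. - f x y) = hs_int N f"
  by (simp add: hs_int_def)

lemma hs_int_triangle_diff: "hs_int N (\<lambda>x y. f x y - g x y) \<le> hs_int N f + hs_int N g"
  using hs_int_triangle[of N f "\<lambda>x y. - g x y"] by simp

lemma hs_int_sum: "hs_int N (\<lambda>x y. \<Sum>i\<in>I. f i x y) \<le> (\<Sum>i\<in>I. hs_int N (f i))"
proof (induction I rule: infinite_finite_induct)
  case (insert i I)
  then show ?case using hs_int_triangle[of N "f i" "\<lambda>x y. \<Sum>i\<in>I. f i x y"] by simp
qed (simp_all add: hs_int_def L2_set_def)

lemma hs_int_transpose: "hs_int N (\<lambda>x y. b y x) = hs_int N b"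
proof -
  let ?Z = "{0..<int N}"
  have "(\<Sum>x\<in>?Z. \<Sum>y\<in>?Z. (cmod (b y x))\<^sup>2) = (\<Sum>x\<in>?Z. \<Sum>y\<in>?Z. (cmod (b x y))\<^sup>2)"
    by (rule sum.swap)
  then show ?thesis
    by (simp add: hs_int_def L2_set_def case_prod_unfold sum.cartesian_product)
qed

lemma hs_int_sq: "(hs_int N b)\<^sup>2 = (\<Sum>x\<in>{0..<int N}. \<Sum>y\<in>{0..<int N}. (cmod (b x y))\<^sup>2)"
  by (simp add: hs_int_def L2_set_def case_prod_unfold sum_nonneg sum.cartesian_product)

text \<open>The unnormalized inner product of \<open>b\<close> with the Weyl unitary that has
  entries \<open>e_char N (a * x)\<close> at \<open>(x, x + c)\<close>. The column
  \<open>x + c\<close> is not reduced, so \<open>b\<close> is meant to be biperiodic.\<close>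

definition weyl_coeff :: "nat \<Rightarrow> (int \<Rightarrow> int \<Rightarrow> complex) \<Rightarrow> int \<times> int \<Rightarrow> complex" where
  "weyl_coeff N b = (\<lambda>(a,c). \<Sum>x\<in>{0..<int N}. b x (x + c) * e_char N (-(a * x)))"

lemma weyl_coeff_diff:
  "weyl_coeff N (\<lambda>x y. b x y - b' x y) p = weyl_coeff N b p - weyl_coeff N b' p"
  by (simp add: weyl_coeff_def case_prod_unfold sum_subtractf left_diff_distrib)

text \<open>For fixed \<open>c\<close> the coefficients are the Fourier transform of one cyclic
  diagonal. The set \<open>C\<close> is left free so that far diagonals can be treated
  alone.\<close>

lemma weyl_coeff_parseval_columns:
  assumes "N > 0"
  shows "(\<Sum>(a,c)\<in>{s..<s + int N} \<times> C. (cmod (weyl_coeff N b (a,c)))\<^sup>2)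
       = real N * (\<Sum>c\<in>C. \<Sum>x\<in>{0..<int N}. (cmod (b x (x + c)))\<^sup>2)"
proof -
  have "(\<Sum>(a,c)\<in>{s..<s + int N} \<times> C. (cmod (weyl_coeff N b (a,c)))\<^sup>2)
      = (\<Sum>a\<in>{s..<s + int N}. \<Sum>c\<in>C. (cmod (weyl_coeff N b (a,c)))\<^sup>2)"
    by (simp add: sum.cartesian_product)
  also have "\<dots> = (\<Sum>c\<in>C. \<Sum>a\<in>{s..<s + int N}. (cmod (weyl_coeff N b (a,c)))\<^sup>2)"
    by (rule sum.swap)
  finally show ?thesis
    by (simp add: weyl_coeff_def fourier_parseval[OF assms] sum_distrib_left)
qed

text \<open>The cyclic diagonals with offsets in a full window meet every matrix position exactly
  once.\<close>

lemma sum_diagonals: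
  assumes "N > 0" "biperiodic N w"
  shows "(\<Sum>c\<in>{s..<s + int N}. \<Sum>x\<in>{0..<int N}. w x (x + c))
       = (\<Sum>x\<in>{0..<int N}. \<Sum>y\<in>{0..<int N}. w x y)"
proof -
  have "(\<Sum>c\<in>{s..<s + int N}. w x (x + c)) = (\<Sum>y\<in>{0..<int N}. w x y)" if "x \<in> {0..<int N}" for x
  proof (rule sum_periodic_shift[OF assms(1)])
    show "periodic N (w x)"
      using assms(2) unfolding periodic_def biperiodic_def by (metis mod_mod_trivial)
  qed
  then show ?thesis
    by (subst sum.swap) simp
qed

lemma weyl_coeff_parseval:
  assumes "N > 0" "biperiodic N b"
  shows "L2_set (\<lambda>p. cmod (weyl_coeff N b p)) ({s..<s + int N} \<times> {s..<s + int N}) = sqrt N * hs_int N b"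
proof -
  have "biperiodic N (\<lambda>x y. (cmod (b x y))\<^sup>2)"
    using assms(2) by (simp add: biperiodic_def)
  from sum_diagonals[OF assms(1) this, of s]
    weyl_coeff_parseval_columns[OF assms(1), of b s "{s..<s + int N}"]
  have "(\<Sum>(a,c)\<in>{s..<s + int N} \<times> {s..<s + int N}. (cmod (weyl_coeff N b (a,c)))\<^sup>2)
     = real N * (\<Sum>x\<in>{0..<int N}. \<Sum>y\<in>{0..<int N}. (cmod (b x y))\<^sup>2)"
    by simp
  then show ?thesis
    by (simp add: L2_set_def hs_int_def case_prod_unfold sum.cartesian_product real_sqrt_mult)
qed

text \<open>A cyclic diagonal whose offset exceeds \<open>k\<close> but not \<open>2 * k\<close> in
  absolute value stays at distance at least \<open>k + 1\<close> from the main diagonal, even after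
  wrap-around. This is more than a quarter of \<open>N\<close>, so the clock weight there is at
  least 1/4; hence the factor 4.\<close>

lemma weyl_coeff_outer:
  assumes N: "int N = 4 * k + 1" "k \<ge> 0" and b: "biperiodic N b"
  shows "L2_set (\<lambda>p. cmod (weyl_coeff N b p)) {(a,c) \<in> {-2*k..2*k} \<times> {-2*k..2*k}. \<bar>c\<bar> > k}
     \<le> sqrt N * (4 * hs_int N (\<lambda>x y. of_real ((real_of_int x - real_of_int y) / real N) * b x y))"
proof -
  let ?Z = "{0..<int N}"
  have N0: "N > 0" using N by (cases N) auto
  define C where "C = {c \<in> {-2*k..2*k}. \<bar>c\<bar> > k}"
  \<comment> \<open>The difference of indices is not periodic, so the weight is computed from
    reduced representatives.\<close>
  define w where "w x y = (real_of_int (x mod int N) - real_of_int (y mod int N))\<^sup>2 * (cmod (b x y))\<^sup>2" for x y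
  have w: "biperiodic N w"
    using b by (simp add: w_def biperiodic_def)
  have R: "{-2*k..2*k} = {-2*k..<-2*k + int N}" using N by auto
  have S: "{(a,c) \<in> {-2*k..2*k} \<times> {-2*k..2*k}. \<bar>c\<bar> > k} = {-2*k..<-2*k + int N} \<times> C"
    unfolding R[symmetric] C_def by auto
  have le: "(cmod (b x (x + c)))\<^sup>2 \<le> 16 / (real N)\<^sup>2 * w x (x + c)" if "c \<in> C" "x \<in> ?Z" for x c
  proof -
    let ?y = "(x + c) mod int N"
    have "\<bar>x - ?y\<bar> \<ge> k + 1"
    proof (rule ccontr)
      assume *: "\<not> ?thesis"
      have "int N dvd (?y - (x + c))" by (simp add: mod_eq_dvd_iff[symmetric])
      then obtain l where "?y - (x + c) = int N * l" ..
      then have l: "c = (?y - x) - int N * l" by simp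
      \<comment> \<open>The multiple of \<open>N\<close> has size at most \<open>3 * k\<close>, so
        it vanishes, and then \<open>c\<close> would have size at most \<open>k\<close>.\<close>
      have "\<bar>int N * l\<bar> < int N * 1" using l * that N unfolding C_def by auto
      then have "int N * \<bar>l\<bar> < int N * 1" by (simp add: abs_mult)
      then have "l = 0" using N0 by (simp only: mult_less_cancel_left) simp
      then show False using l * that unfolding C_def by auto
    qed
    then have "4 * \<bar>x - ?y\<bar> \<ge> int N" using N by simp
    then have "real_of_int (int N) \<le> real_of_int (4 * \<bar>x - ?y\<bar>)" by (simp only: of_int_le_iff)
    then have "real N \<le> 4 * \<bar>real_of_int x - real_of_int ?y\<bar>" by simp
    then have "(real N)\<^sup>2 \<le> (4 * \<bar>real_of_int x - real_of_int ?y\<bar>)\<^sup>2"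
      by (intro power_mono) auto
    then have "1 \<le> 16 / (real N)\<^sup>2 * (real_of_int x - real_of_int ?y)\<^sup>2"
      using N0 by (simp add: power_mult_distrib field_simps)
    then have "1 * (cmod (b x (x + c)))\<^sup>2
        \<le> (16 / (real N)\<^sup>2 * (real_of_int x - real_of_int ?y)\<^sup>2) * (cmod (b x (x + c)))\<^sup>2"
      by (rule mult_right_mono) simp
    then show ?thesis using that by (simp add: w_def)
  qed
  have "(\<Sum>(a,c)\<in>{-2*k..<-2*k + int N} \<times> C. (cmod (weyl_coeff N b (a,c)))\<^sup>2)
      = real N * (\<Sum>c\<in>C. \<Sum>x\<in>?Z. (cmod (b x (x + c)))\<^sup>2)"
    by (rule weyl_coeff_parseval_columns[OF N0])
  also have "\<dots> \<le> real N * (\<Sum>c\<in>C. \<Sum>x\<in>?Z. 16 / (real N)\<^sup>2 * w x (x + c))"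
    by (intro mult_left_mono sum_mono le) auto
  also have "\<dots> \<le> real N * (\<Sum>c\<in>{-2*k..<-2*k + int N}. \<Sum>x\<in>?Z. 16 / (real N)\<^sup>2 * w x (x + c))"
    by (intro mult_left_mono sum_mono2) (use N in \<open>auto simp: C_def w_def sum_nonneg\<close>)
  also have "\<dots> = real N * (16 / (real N)\<^sup>2 * (\<Sum>x\<in>?Z. \<Sum>y\<in>?Z. w x y))"
    unfolding sum_diagonals[OF N0 w, of "-2*k", symmetric] by (simp only: sum_distrib_left)
  also have "\<dots> = real N * (16 * (\<Sum>x\<in>?Z. \<Sum>y\<in>?Z. w x y / (real N)\<^sup>2))"
    by (simp add: sum_divide_distrib[symmetric])
  also have "(\<Sum>x\<in>?Z. \<Sum>y\<in>?Z. w x y / (real N)\<^sup>2)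
      = (\<Sum>x\<in>?Z. \<Sum>y\<in>?Z. (cmod (of_real ((real_of_int x - real_of_int y) / real N) * b x y))\<^sup>2)"
    by (intro sum.cong refl) (simp add: w_def norm_mult power_mult_distrib power_divide norm_divide
        flip: of_real_diff)
  finally have "L2_set (\<lambda>p. cmod (weyl_coeff N b p)) ({-2*k..<-2*k + int N} \<times> C)
     \<le> sqrt (real N * (16 * (\<Sum>x\<in>?Z. \<Sum>y\<in>?Z. (cmod (of_real ((real_of_int x - real_of_int y) / real N) * b x y))\<^sup>2)))"
    unfolding L2_set_def by (intro real_sqrt_le_mono) (simp add: case_prod_unfold)
  then show ?thesis unfolding S
    by (simp add: L2_set_def hs_int_def case_prod_unfold sum.cartesian_product real_sqrt_mult)
qed

section \<open>The quadratic phase acts on Weyl coefficients as a shear\<close>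

definition triangular :: "int \<Rightarrow> int" where
  "triangular x = x * (x - 1) div 2"

lemma double_triangular: "2 * triangular x = x * (x - 1)"
  unfolding triangular_def by (intro dvd_mult_div_cancel) auto

definition quad_phase :: "nat \<Rightarrow> int \<Rightarrow> complex" where
  "quad_phase N x = e_char N (triangular x)"

text \<open>The increment of a quadratic exponent is linear in \<open>x\<close> up to a constant, so
  conjugation by the phase multiplies each cyclic diagonal by a character.\<close>

lemma quad_phase_shift:
  "quad_phase N x * cnj (quad_phase N (x + c)) = e_char N (-(c * x)) * cnj (quad_phase N c)"
proof -
  have "2 * (triangular x + - triangular (x + c)) = 2 * (-(c * x) + - triangular c)"
    by (simp only: distrib_left double_triangular mult_minus_right) (simp add: algebra_simps)
  then have "triangular x + - triangular (x + c) = -(c * x) + - triangular c"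
    by (metis mult_left_cancel zero_neq_numeral)
  then show ?thesis
    by (simp only: quad_phase_def cnj_e_char e_char_add[symmetric])
qed

text \<open>Lowering \<open>x\<close> by \<open>N * l\<close> changes the exponent by
  \<open>N\<close> times half of \<open>l * (N * l + 1 - 2 * x)\<close>; for odd \<open>N\<close>
  that product is even, so the change is a multiple of \<open>N\<close>.\<close>

lemma quad_phase_periodic:
  assumes "odd N"
  shows "quad_phase N (x mod int N) = quad_phase N x"
proof -
  have N: "N > 0" using assms by (cases N) auto
  define l where "l = x div int N"
  have x: "x mod int N = x - int N * l" by (simp add: l_def minus_mult_div_eq_mod)
  have "2 * (triangular (x mod int N) - triangular x) = int N * (l * (int N * l + 1 - 2 * x))"
    by (simp only: right_diff_distrib double_triangular) (simp add: x algebra_simps)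
  moreover have "even (l * (int N * l + 1 - 2 * x))"
    using assms by (cases "even l") auto
  then obtain t where "l * (int N * l + 1 - 2 * x) = 2 * t" ..
  ultimately have "triangular (x mod int N) - triangular x = int N * t"
    by simp
  then show ?thesis unfolding quad_phase_def by (intro e_char_cong[OF N]) simp
qed

lemma cmod_quad_phase [simp]: "cmod (quad_phase N x) = 1"
  by (simp add: quad_phase_def)

lemma weyl_coeff_quad_phase:
  "weyl_coeff N (\<lambda>x y. quad_phase N x * b x y * cnj (quad_phase N y)) (a, c)
   = cnj (quad_phase N c) * weyl_coeff N b (a + c, c)"
proof -
  have "quad_phase N x * b x (x + c) * cnj (quad_phase N (x + c)) * e_char N (-(a * x))
     = cnj (quad_phase N c) * (b x (x + c) * e_char N (-((a + c) * x)))" for x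
  proof -
    have "quad_phase N x * b x (x + c) * cnj (quad_phase N (x + c)) * e_char N (-(a * x))
      = (quad_phase N x * cnj (quad_phase N (x + c))) * (b x (x + c) * e_char N (-(a * x)))"
      by simp
    also have "\<dots> = cnj (quad_phase N c) * (b x (x + c) * (e_char N (-(a * x)) * e_char N (-(c * x))))"
      unfolding quad_phase_shift by (simp add: ac_simps)
    finally show ?thesis by (simp add: algebra_simps flip: e_char_add)
  qed
  then show ?thesis by (simp only: weyl_coeff_def prod.case sum_distrib_left)
qed

text \<open>Absolute values remove the phase depending on \<open>c\<close> and leave a pure shear of
  the index. The reverse triangle inequality bounds the defect by the coefficients of
  \<open>d\<close>, which Parseval evaluates.\<close>

lemma weyl_shear:
  assumes N: "odd N" and b: "biperiodic N b" "biperiodic N b'"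
  shows "L2_set (\<lambda>(a,c). cmod (weyl_coeff N b' (a + c, c)) - cmod (weyl_coeff N b (a, c)))
        ({s..<s + int N} \<times> {s..<s + int N})
     \<le> sqrt N * hs_int N (\<lambda>x y. quad_phase N x * b' x y - b x y * quad_phase N y)"
proof -
  have N0: "N > 0" using N by (cases N) auto
  define d where "d x y = quad_phase N x * b' x y * cnj (quad_phase N y) - b x y" for x y
  have "biperiodic N d"
    using b by (simp add: biperiodic_def d_def quad_phase_periodic[OF N])
  have "\<bar>cmod (weyl_coeff N b' (a + c, c)) - cmod (weyl_coeff N b (a, c))\<bar> \<le> cmod (weyl_coeff N d (a,c))" for a c
  proof -
    have "weyl_coeff N d (a,c) = cnj (quad_phase N c) * weyl_coeff N b' (a + c, c) - weyl_coeff N b (a,c)"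
      unfolding d_def weyl_coeff_diff weyl_coeff_quad_phase ..
    then show ?thesis
      using norm_triangle_ineq3[of "cnj (quad_phase N c) * weyl_coeff N b' (a + c, c)" "weyl_coeff N b (a,c)"]
      by (simp add: norm_mult)
  qed
  then have "L2_set (\<lambda>(a,c). \<bar>cmod (weyl_coeff N b' (a + c, c)) - cmod (weyl_coeff N b (a, c))\<bar>)
        ({s..<s + int N} \<times> {s..<s + int N})
     \<le> L2_set (\<lambda>p. cmod (weyl_coeff N d p)) ({s..<s + int N} \<times> {s..<s + int N})"
    by (intro L2_set_mono) auto
  also have "\<dots> = sqrt N * hs_int N d"
    by (rule weyl_coeff_parseval) fact+
  \<comment> \<open>Multiplication by the unimodular \<open>quad_phase N y\<close> turns conjugation
    into an intertwining difference without changing absolute values.\<close>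
  also have "cmod (d x y) = cmod (quad_phase N x * b' x y - b x y * quad_phase N y)" for x y
  proof -
    have "cnj (quad_phase N y) * quad_phase N y = 1"
      by (simp add: quad_phase_def mult.commute e_char_mult_uminus)
    then have "d x y * quad_phase N y = quad_phase N x * b' x y - b x y * quad_phase N y"
      by (simp add: d_def algebra_simps)
    then show ?thesis by (metis cmod_quad_phase mult.right_neutral norm_mult)
  qed
  then have "hs_int N d = hs_int N (\<lambda>x y. quad_phase N x * b' x y - b x y * quad_phase N y)"
    by (simp add: hs_int_def)
  finally show ?thesis by (simp add: L2_set_def case_prod_unfold)
qed

section \<open>The discrete Fourier transform acts on Weyl coefficients as a quarter turn\<close>

definition dft :: "nat \<Rightarrow> int \<Rightarrow> int \<Rightarrow> complex" where
  "dft N x y = e_char N (x * y) / of_real (sqrt (real N))"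

text \<open>For \<open>h = b \<cdot> dft\<close> this is the Weyl coefficient of \<open>b\<close>, and for \<open>h = dft \<cdot> b\<close> it is,
  up to a phase, the Weyl coefficient of \<open>b\<close> at the rotated point.\<close>

definition mixed_coeff :: "nat \<Rightarrow> (int \<Rightarrow> int \<Rightarrow> complex) \<Rightarrow> int \<times> int \<Rightarrow> complex" where
  "mixed_coeff N h = (\<lambda>(a,c).
     (\<Sum>x\<in>{0..<int N}. (\<Sum>y\<in>{0..<int N}. h x y * e_char N (-(x * y)) * e_char N (-(c * y))) * e_char N (-(a * x)))
       / of_real (sqrt (real N)))"

lemma mixed_coeff_diff:
  "mixed_coeff N (\<lambda>x y. b x y - b' x y) p = mixed_coeff N b p - mixed_coeff N b' p"
  by (simp add: mixed_coeff_def case_prod_unfold sum_subtractf left_diff_distrib diff_divide_distrib)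

text \<open>Parseval is applied over \<open>a\<close> and then over \<open>c\<close>. The factor
  \<open>e_char N (-(x * y))\<close> is unimodular, and the normalization cancels one of the two
  factors \<open>N\<close>.\<close>

lemma mixed_coeff_parseval:
  assumes "N > 0"
  shows "L2_set (\<lambda>p. cmod (mixed_coeff N h p)) ({s..<s + int N} \<times> {s..<s + int N}) = sqrt N * hs_int N h"
proof -
  let ?I = "{s..<s + int N}" and ?Z = "{0..<int N}"
  define H where "H c x = (\<Sum>y\<in>?Z. h x y * e_char N (-(x * y)) * e_char N (-(c * y)))" for c x
  have "(\<Sum>p\<in>?I \<times> ?I. (cmod (mixed_coeff N h p))\<^sup>2) = (\<Sum>a\<in>?I. \<Sum>c\<in>?I. (cmod (mixed_coeff N h (a,c)))\<^sup>2)"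
    by (simp add: sum.cartesian_product)
  also have "\<dots> = (\<Sum>c\<in>?I. \<Sum>a\<in>?I. (cmod (mixed_coeff N h (a,c)))\<^sup>2)"
    by (rule sum.swap)
  also have "\<dots> = (\<Sum>c\<in>?I. \<Sum>a\<in>?I. (cmod (\<Sum>x\<in>?Z. H c x * e_char N (-(a * x))))\<^sup>2 / real N)"
    by (simp add: mixed_coeff_def H_def norm_divide power_divide)
  also have "\<dots> = (\<Sum>c\<in>?I. \<Sum>x\<in>?Z. (cmod (H c x))\<^sup>2)"
    using assms by (simp add: sum_divide_distrib[symmetric] fourier_parseval[OF assms])
  also have "\<dots> = (\<Sum>x\<in>?Z. \<Sum>c\<in>?I. (cmod (H c x))\<^sup>2)"
    by (rule sum.swap)
  also have "\<dots> = (\<Sum>x\<in>?Z. real N * (\<Sum>y\<in>?Z. (cmod (h x y))\<^sup>2))"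
    by (simp add: H_def fourier_parseval[OF assms] norm_mult)
  finally show ?thesis
    by (simp add: L2_set_def hs_int_def sum.cartesian_product case_prod_unfold real_sqrt_mult
        flip: sum_distrib_left)
qed

lemma sum_e_char_select:
  assumes "N > 0" "periodic N w"
  shows "(\<Sum>z\<in>{0..<int N}. w z * (\<Sum>y\<in>{0..<int N}. e_char N ((z - t) * y))) = of_nat N * w t"
proof -
  have "(\<Sum>z\<in>{0..<int N}. w z * (\<Sum>y\<in>{0..<int N}. e_char N ((z - t) * y)))
      = (\<Sum>z\<in>{0..<int N}. if z = t mod int N then w z * of_nat N else 0)"
  proof (intro sum.cong refl)
    fix z assume "z \<in> {0..<int N}"
    then have "int N dvd z - t \<longleftrightarrow> z = t mod int N"
      by (simp add: mod_eq_dvd_iff[symmetric])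
    then show "w z * (\<Sum>y\<in>{0..<int N}. e_char N ((z - t) * y)) = (if z = t mod int N then w z * of_nat N else 0)"
      by (simp add: sum_e_char[OF assms(1)])
  qed
  also have "\<dots> = w (t mod int N) * of_nat N" using assms(1) by simp
  finally show ?thesis using assms(2) by (simp add: periodic_def)
qed

lemma biperiodic_imp_periodic:
  assumes "biperiodic N b"
  shows "periodic N (b x)" "periodic N (\<lambda>x. b x y)"
  using assms unfolding periodic_def biperiodic_def by (metis mod_mod_trivial)+

lemma of_real_sqrt_mult_self [simp]:
  "complex_of_real (sqrt (real N)) * complex_of_real (sqrt (real N)) = of_nat N"
  by (simp flip: of_real_mult)

text \<open>The sum over \<open>y\<close> inverts the transform: orthogonality selects
  \<open>z\<close> congruent to \<open>x + c\<close>.\<close>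

lemma mixed_coeff_mult_dft:
  assumes N: "N > 0" and b: "biperiodic N b"
  shows "mixed_coeff N (\<lambda>x y. \<Sum>z\<in>{0..<int N}. b x z * dft N z y) (a, c) = weyl_coeff N b (a, c)"
proof -
  let ?Z = "{0..<int N}" and ?r = "complex_of_real (sqrt (real N))"
  have r: "?r \<noteq> 0" using N by simp
  have "(\<Sum>y\<in>?Z. (\<Sum>z\<in>?Z. b x z * dft N z y) * e_char N (-(x * y)) * e_char N (-(c * y)))
      = ?r * b x (x + c)" for x
  proof -
    have "(\<Sum>y\<in>?Z. (\<Sum>z\<in>?Z. b x z * dft N z y) * e_char N (-(x * y)) * e_char N (-(c * y)))
      = (\<Sum>y\<in>?Z. \<Sum>z\<in>?Z. b x z * e_char N ((z - (x + c)) * y) / ?r)"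
    proof (intro sum.cong refl)
      fix y
      have e: "e_char N ((z - (x + c)) * y) = e_char N (z * y) * e_char N (-(x * y)) * e_char N (-(c * y))" for z
        by (simp add: algebra_simps flip: e_char_add)
      show "(\<Sum>z\<in>?Z. b x z * dft N z y) * e_char N (-(x * y)) * e_char N (-(c * y))
         = (\<Sum>z\<in>?Z. b x z * e_char N ((z - (x + c)) * y) / ?r)"
        unfolding e by (simp add: dft_def sum_distrib_right mult.assoc)
    qed
    also have "\<dots> = (\<Sum>z\<in>?Z. \<Sum>y\<in>?Z. b x z * e_char N ((z - (x + c)) * y) / ?r)"
      by (rule sum.swap)
    also have "\<dots> = (\<Sum>z\<in>?Z. b x z * (\<Sum>y\<in>?Z. e_char N ((z - (x + c)) * y))) / ?r"
      by (simp add: sum_distrib_left sum_divide_distrib)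
    also have "\<dots> = of_nat N / ?r * b x (x + c)"
      by (simp add: sum_e_char_select[OF N biperiodic_imp_periodic(1)[OF b]])
    also have "of_nat N / ?r = ?r"
      using r of_real_sqrt_mult_self[of N] by (metis nonzero_mult_div_cancel_right)
    finally show ?thesis .
  qed
  then show ?thesis using r
    by (simp add: mixed_coeff_def weyl_coeff_def sum_distrib_left[symmetric] mult.assoc)
qed

text \<open>Here the sum over \<open>x\<close> selects \<open>z\<close> congruent to
  \<open>a + y\<close>, leaving the diagonal of offset \<open>-a\<close> at frequency
  \<open>c\<close>. Reindexing by the row \<open>a + y\<close> produces the phase.\<close>

lemma mixed_coeff_dft_mult:
  assumes N: "N > 0" and b: "biperiodic N b"
  shows "mixed_coeff N (\<lambda>x y. \<Sum>z\<in>{0..<int N}. dft N x z * b z y) (a, c)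
     = e_char N (c * a) * weyl_coeff N b (c, -a)"
proof -
  let ?Z = "{0..<int N}" and ?r = "complex_of_real (sqrt (real N))"
  have r: "?r \<noteq> 0" using N by simp
  have "(\<Sum>x\<in>?Z. (\<Sum>y\<in>?Z. (\<Sum>z\<in>?Z. dft N x z * b z y) * e_char N (-(x * y)) * e_char N (-(c * y))) * e_char N (-(a * x)))
     = (\<Sum>x\<in>?Z. \<Sum>y\<in>?Z. \<Sum>z\<in>?Z. e_char N (-(c * y)) * (b z y * e_char N ((z - (a + y)) * x)) / ?r)"
  proof (intro sum.cong refl)
    fix x
    have e: "e_char N ((z - (a + y)) * x) = e_char N (x * z) * e_char N (-(x * y)) * e_char N (-(a * x))" for z y
      by (simp add: algebra_simps flip: e_char_add)
    show "(\<Sum>y\<in>?Z. (\<Sum>z\<in>?Z. dft N x z * b z y) * e_char N (-(x * y)) * e_char N (-(c * y))) * e_char N (-(a * x))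
      = (\<Sum>y\<in>?Z. \<Sum>z\<in>?Z. e_char N (-(c * y)) * (b z y * e_char N ((z - (a + y)) * x)) / ?r)"
      unfolding e by (simp add: dft_def sum_distrib_right sum_distrib_left ac_simps)
  qed
  also have "\<dots> = (\<Sum>y\<in>?Z. \<Sum>x\<in>?Z. \<Sum>z\<in>?Z. e_char N (-(c * y)) * (b z y * e_char N ((z - (a + y)) * x)) / ?r)"
    by (rule sum.swap)
  also have "\<dots> = (\<Sum>y\<in>?Z. \<Sum>z\<in>?Z. \<Sum>x\<in>?Z. e_char N (-(c * y)) * (b z y * e_char N ((z - (a + y)) * x)) / ?r)"
    by (intro sum.cong refl sum.swap)
  also have "\<dots> = (\<Sum>y\<in>?Z. e_char N (-(c * y)) * (\<Sum>z\<in>?Z. b z y * (\<Sum>x\<in>?Z. e_char N ((z - (a + y)) * x))) / ?r)"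
    by (simp add: sum_distrib_left sum_divide_distrib)
  also have "\<dots> = (\<Sum>y\<in>?Z. e_char N (-(c * y)) * (of_nat N * b (a + y) y) / ?r)"
    by (simp add: sum_e_char_select[OF N biperiodic_imp_periodic(2)[OF b]])
  also have "\<dots> = (\<Sum>y\<in>?Z. b (a + y) y * e_char N (-(c * y))) * ?r"
    using r by (simp add: of_real_sqrt_mult_self[symmetric] sum_distrib_left ac_simps del: of_real_sqrt_mult_self)
  finally have 1: "mixed_coeff N (\<lambda>x y. \<Sum>z\<in>{0..<int N}. dft N x z * b z y) (a, c)
      = (\<Sum>y\<in>?Z. b (a + y) y * e_char N (-(c * y)))"
    using r by (simp add: mixed_coeff_def)
  have "periodic N (\<lambda>x. b x (x + -a) * e_char N (-(c * x)))"
    unfolding periodic_def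
  proof
    fix x
    have "e_char N (-(c * (x mod int N))) = e_char N (-(c * x))"
      using periodic_e_char[OF N, of "-c"] by (simp add: periodic_def)
    moreover have "b (x mod int N) (x mod int N + -a) = b x (x + -a)"
      using b unfolding biperiodic_def by (metis mod_add_left_eq mod_mod_trivial)
    ultimately show "b (x mod int N) (x mod int N + -a) * e_char N (-(c * (x mod int N)))
       = b x (x + -a) * e_char N (-(c * x))" by simp
  qed
  from sum_periodic_shift[OF N this, of a 0]
  have "weyl_coeff N b (c, -a) = (\<Sum>y\<in>?Z. b (a + y) y * e_char N (-(c * (a + y))))"
    by (simp add: weyl_coeff_def)
  also have "\<dots> = e_char N (-(c * a)) * (\<Sum>y\<in>?Z. b (a + y) y * e_char N (-(c * y)))"
  proof -
    have "e_char N (-(c * (a + y))) = e_char N (-(c * a)) * e_char N (-(c * y))" for y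
      by (simp add: algebra_simps flip: e_char_add)
    then show ?thesis by (simp add: sum_distrib_left mult.left_commute)
  qed
  finally show ?thesis
    using 1 e_char_mult_uminus[of N "c * a"] by (simp flip: mult.assoc)
qed

text \<open>Evaluating \<open>mixed_coeff\<close> on both products with \<open>dft\<close> yields
  the two coefficients to be compared, up to a phase, so the intertwining difference is used
  directly.\<close>

lemma weyl_rotate:
  assumes N: "N > 0" and b: "biperiodic N b" "biperiodic N b'"
  shows "L2_set (\<lambda>(a,c). cmod (weyl_coeff N b' (c, -a)) - cmod (weyl_coeff N b (a, c)))
        ({s..<s + int N} \<times> {s..<s + int N})
     \<le> sqrt N * hs_int N (\<lambda>x y. (\<Sum>z\<in>{0..<int N}. dft N x z * b' z y) - (\<Sum>z\<in>{0..<int N}. b x z * dft N z y))"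
    (is "_ \<le> sqrt N * hs_int N ?d")
proof -
  have "\<bar>cmod (weyl_coeff N b' (c, -a)) - cmod (weyl_coeff N b (a, c))\<bar> \<le> cmod (mixed_coeff N ?d (a,c))" for a c
    using norm_triangle_ineq3[of "e_char N (c * a) * weyl_coeff N b' (c, -a)" "weyl_coeff N b (a,c)"]
    by (simp add: mixed_coeff_diff mixed_coeff_dft_mult[OF N b(2)] mixed_coeff_mult_dft[OF N b(1)] norm_mult)
  then have "L2_set (\<lambda>(a,c). \<bar>cmod (weyl_coeff N b' (c, -a)) - cmod (weyl_coeff N b (a, c))\<bar>)
        ({s..<s + int N} \<times> {s..<s + int N})
     \<le> L2_set (\<lambda>p. cmod (mixed_coeff N ?d p)) ({s..<s + int N} \<times> {s..<s + int N})"
    by (intro L2_set_mono) auto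
  also have "\<dots> = sqrt N * hs_int N ?d"
    by (rule mixed_coeff_parseval[OF N])
  finally show ?thesis by (simp add: L2_set_def case_prod_unfold)
qed

section \<open>The estimate for one diagonal block\<close>

text \<open>The absolute coefficients of \<open>b1\<close> satisfy the hypotheses of ping-pong:
  \<open>clock\<close> gives the outer bound, \<open>shear\<close> and \<open>rot\<close> the
  near-invariance after \<open>b2\<close> and \<open>b3\<close> are replaced by \<open>b1\<close>.
  The remaining point, the origin, is controlled by the traces.\<close>

lemma weyl_gap:
  assumes N: "int N = 4 * k + 1" "k \<ge> 0"
    and b: "biperiodic N b0" "biperiodic N b1" "biperiodic N b2" "biperiodic N b3"
    and tr: "(\<Sum>x\<in>{0..<int N}. b0 x x) + (\<Sum>x\<in>{0..<int N}. b1 x x)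
        + (\<Sum>x\<in>{0..<int N}. b2 x x) + (\<Sum>x\<in>{0..<int N}. b3 x x) = 0"
    and clock: "hs_int N (\<lambda>x y. of_real ((real_of_int x - real_of_int y) / real N) * b1 x y) \<le> \<eta>"
    and one: "hs_int N (\<lambda>x y. b1 x y - b0 x y) \<le> \<eta>"
    and two: "hs_int N (\<lambda>x y. b1 x y - b2 x y) \<le> 2 * \<eta>"
    and three: "hs_int N (\<lambda>x y. b1 x y - b3 x y) \<le> 2 * \<eta>"
    and shear: "hs_int N (\<lambda>x y. quad_phase N x * b2 x y - b1 x y * quad_phase N y) \<le> \<eta>"
    and rot: "hs_int N (\<lambda>x y. (\<Sum>z\<in>{0..<int N}. dft N x z * b3 z y) - (\<Sum>z\<in>{0..<int N}. b1 x z * dft N z y)) \<le> \<eta>"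
  shows "hs_int N b1 \<le> 174 * \<eta>"
proof -
  define R where "R = {-2*k..2*k}"
  have R: "R = {-2*k..<-2*k + int N}" using N by (auto simp: R_def)
  have finR: "finite (R \<times> R)" by (simp add: R_def)
  have N0: "N > 0" and oddN: "odd N" using N by (cases N; simp; presburger)+
  \<comment> \<open>Parseval scales Hilbert-Schmidt norms by \<open>sqrt N\<close>, so coefficients
    are measured in this unit.\<close>
  define E where "E = sqrt N * \<eta>"
  have E: "sqrt N * t \<le> r * E" if "t \<le> r * \<eta>" for t r
    using mult_left_mono[OF that, of "sqrt N"] by (simp add: E_def ac_simps)
  define g where "g p = cmod (weyl_coeff N b1 p)" for p
  define h where "h b p = cmod (weyl_coeff N b p)" for b p
  have close: "L2_set (\<lambda>p. g p - h b p) S \<le> sqrt N * hs_int N (\<lambda>x y. b1 x y - b x y)"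
    "L2_set (\<lambda>p. cmod (weyl_coeff N (\<lambda>x y. b1 x y - b x y) p)) (R \<times> R) = sqrt N * hs_int N (\<lambda>x y. b1 x y - b x y)"
    if "biperiodic N b" "S \<subseteq> R \<times> R" for b S
  proof -
    have "biperiodic N (\<lambda>x y. b1 x y - b x y)"
      using that(1) b(2) by (simp add: biperiodic_def)
    from weyl_coeff_parseval[OF N0 this, of "-2*k"]
    show *: "L2_set (\<lambda>p. cmod (weyl_coeff N (\<lambda>x y. b1 x y - b x y) p)) (R \<times> R) = sqrt N * hs_int N (\<lambda>x y. b1 x y - b x y)"
      by (simp add: R)
    have "L2_set (\<lambda>p. g p - h b p) S = L2_set (\<lambda>p. \<bar>g p - h b p\<bar>) S"
      by (simp add: L2_set_def)
    also have "\<dots> \<le> L2_set (\<lambda>p. cmod (weyl_coeff N (\<lambda>x y. b1 x y - b x y) p)) S"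
      by (intro L2_set_mono) (auto simp: g_def h_def weyl_coeff_diff norm_triangle_ineq3)
    also have "\<dots> \<le> L2_set (\<lambda>p. cmod (weyl_coeff N (\<lambda>x y. b1 x y - b x y) p)) (R \<times> R)"
      using that(2) finR by (intro L2_set_subset)
    finally show "L2_set (\<lambda>p. g p - h b p) S \<le> sqrt N * hs_int N (\<lambda>x y. b1 x y - b x y)"
      using * by simp
  qed
  \<comment> \<open>Replacing \<open>b\<close> by \<open>b1\<close> adds \<open>2 * E\<close> to the
    defect \<open>E\<close>.\<close>
  have transfer: "L2_set (\<lambda>p. g (\<phi> p) - g p) S \<le> 3 * E"
    if "biperiodic N b" "hs_int N (\<lambda>x y. b1 x y - b x y) \<le> 2 * \<eta>" "inj_on \<phi> S" "\<phi> ` S \<subseteq> R \<times> R"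
      and "L2_set (\<lambda>p. h b (\<phi> p) - g p) S \<le> E" for b \<phi> S
  proof -
    have "L2_set (\<lambda>p. g (\<phi> p) - g p) S = L2_set (\<lambda>p. (g (\<phi> p) - h b (\<phi> p)) + (h b (\<phi> p) - g p)) S"
      by simp
    also have "\<dots> \<le> L2_set (\<lambda>p. g (\<phi> p) - h b (\<phi> p)) S + L2_set (\<lambda>p. h b (\<phi> p) - g p) S"
      by (rule L2_set_triangle_ineq)
    also have "L2_set (\<lambda>p. g (\<phi> p) - h b (\<phi> p)) S = L2_set (\<lambda>p. g p - h b p) (\<phi> ` S)"
      using that(3) by (simp add: L2_set_reindex)
    finally show ?thesis using close(1)[OF that(1,4)] that(5) E[OF that(2)] by simp
  qed
  have E0: "E \<ge> 0"
    using one by (auto simp: E_def hs_int_def intro!: mult_nonneg_nonneg intro: order_trans[OF L2_set_nonneg])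
  \<comment> \<open>Shear and rotation cost \<open>3 * E\<close> and the outer bound
    \<open>4 * E\<close>; the larger one serves for all, giving \<open>172 * E\<close>.\<close>
  have "L2_set g (R \<times> R - {(0,0)}) \<le> 43 * (4 * E)"
    unfolding R_def
  proof (rule ping_pong)
    let ?S = "{(a,c) \<in> {-2*k..2*k} \<times> {-2*k..2*k}. a + c \<in> {-2*k..2*k}}"
    have "L2_set (\<lambda>p. g ((\<lambda>(a,c). (a + c, c)) p) - g p) ?S \<le> 3 * E"
    proof (rule transfer[OF b(3) two])
      have "L2_set (\<lambda>p. h b2 ((\<lambda>(a,c). (a + c, c)) p) - g p) ?S
        \<le> L2_set (\<lambda>p. h b2 ((\<lambda>(a,c). (a + c, c)) p) - g p) (R \<times> R)"
        using finR by (intro L2_set_subset) (auto simp: R_def)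
      also have "\<dots> \<le> E"
        using weyl_shear[OF oddN b(2) b(3), of "-2*k"] E[of _ 1] shear
        by (force simp: h_def g_def case_prod_unfold R)
      finally show "L2_set (\<lambda>p. h b2 ((\<lambda>(a,c). (a + c, c)) p) - g p) ?S \<le> E" .
    qed (auto simp: inj_on_def R_def)
    then show "L2_set (\<lambda>(a,c). g (a + c, c) - g (a, c)) ?S \<le> 4 * E"
      using E0 by (simp add: case_prod_unfold)
    have "L2_set (\<lambda>p. g ((\<lambda>(a,c). (c, -a)) p) - g p) (R \<times> R) \<le> 3 * E"
    proof (rule transfer[OF b(4) three])
      show "L2_set (\<lambda>p. h b3 ((\<lambda>(a,c). (c, -a)) p) - g p) (R \<times> R) \<le> E"
        using weyl_rotate[OF N0 b(2) b(4), of "-2*k"] E[of _ 1] rot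
        by (force simp: h_def g_def case_prod_unfold R)
    qed (auto simp: inj_on_def R_def)
    then show "L2_set (\<lambda>(a,c). g (c, -a) - g (a, c)) ({-2*k..2*k} \<times> {-2*k..2*k}) \<le> 4 * E"
      using E0 by (simp add: case_prod_unfold R_def)
    show "L2_set g {(a,c) \<in> {-2*k..2*k} \<times> {-2*k..2*k}. \<bar>c\<bar> > k} \<le> 4 * E"
      using order_trans[OF weyl_coeff_outer[OF N b(2)] E[of _ 4]] clock unfolding g_def by simp
  qed (use N in auto)
  \<comment> \<open>The coefficient at the origin is the trace. Since the four traces sum to zero,
    \<open>4 * t b1\<close> is a sum of three trace differences, of total size at most
    \<open>5 * E\<close>; each difference is a single coefficient and so is bounded by the full
    norm.\<close>
  moreover have "g (0,0) \<le> 2 * E"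
  proof -
    define t where "t b = (\<Sum>x\<in>{0..<int N}. b x x)" for b :: "int \<Rightarrow> int \<Rightarrow> complex"
    have "cmod (t b1 - t b) \<le> sqrt N * hs_int N (\<lambda>x y. b1 x y - b x y)" if "biperiodic N b" for b
    proof -
      have "(0,0) \<in> R \<times> R" using N by (simp add: R_def)
      from member_le_L2_set[OF finR this, of "\<lambda>p. cmod (weyl_coeff N (\<lambda>x y. b1 x y - b x y) p)"]
      show ?thesis using close(2)[OF that order_refl] by (simp add: weyl_coeff_def t_def sum_subtractf)
    qed
    from this[OF b(1)] this[OF b(3)] this[OF b(4)] E[of _ 1] E[OF two] E[OF three] one
    have "cmod (t b1 - t b0) \<le> E" "cmod (t b1 - t b2) \<le> 2 * E" "cmod (t b1 - t b3) \<le> 2 * E"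
      by force+
    moreover have "4 * t b1 = (t b1 - t b0) + (t b1 - t b2) + (t b1 - t b3)"
      using tr by (simp add: t_def algebra_simps)
    then have "cmod (4 * t b1) \<le> cmod (t b1 - t b0) + cmod (t b1 - t b2) + cmod (t b1 - t b3)"
      by (metis norm_triangle_mono norm_triangle_ineq order_refl)
    ultimately have "4 * cmod (t b1) \<le> 5 * E" by (simp add: norm_mult)
    moreover have "g (0,0) = cmod (t b1)" by (simp add: g_def t_def weyl_coeff_def)
    ultimately show ?thesis using E0 by simp
  qed
  moreover have "L2_set g (R \<times> R) \<le> L2_set g (R \<times> R - {(0,0)}) + L2_set g {(0,0)}"
    using finR by (intro order_trans[OF L2_set_subset L2_set_Un_le]) auto
  moreover have "L2_set g {(0,0)} = g (0,0)" by (simp add: g_def)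
  ultimately have "L2_set g (R \<times> R) \<le> 174 * E" by simp
  moreover have "L2_set g (R \<times> R) = sqrt N * hs_int N b1"
    unfolding g_def R by (rule weyl_coeff_parseval[OF N0 b(2)])
  ultimately have "sqrt N * hs_int N b1 \<le> sqrt N * (174 * \<eta>)" by (simp add: E_def)
  then show ?thesis using N0 by simp
qed

section \<open>Four coupled blocks\<close>



text \<open>Operator norm at most 1 on the integer window.\<close>

definition nonexpansive :: "nat \<Rightarrow> (int \<Rightarrow> int \<Rightarrow> complex) \<Rightarrow> bool" where
  "nonexpansive N V \<longleftrightarrow> (\<forall>w. L2_set (\<lambda>x. cmod (\<Sum>z\<in>{0..<int N}. V x z * w z)) {0..<int N}
     \<le> L2_set (\<lambda>x. cmod (w x)) {0..<int N})"

lemma nonexpansive_cnj: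
  assumes "nonexpansive N V"
  shows "nonexpansive N (\<lambda>x y. cnj (V x y))"
  unfolding nonexpansive_def
proof
  fix w
  have "cmod (\<Sum>z\<in>{0..<int N}. cnj (V x z) * w z) = cmod (\<Sum>z\<in>{0..<int N}. V x z * cnj (w z))" for x
  proof -
    have "(\<Sum>z\<in>{0..<int N}. cnj (V x z) * w z) = cnj (\<Sum>z\<in>{0..<int N}. V x z * cnj (w z))"
      by simp
    then show ?thesis by (simp only: complex_mod_cnj)
  qed
  then show "L2_set (\<lambda>x. cmod (\<Sum>z\<in>{0..<int N}. cnj (V x z) * w z)) {0..<int N}
     \<le> L2_set (\<lambda>x. cmod (w x)) {0..<int N}"
    using assms[unfolded nonexpansive_def, rule_format, of "\<lambda>z. cnj (w z)"] by simp
qed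

lemma nonexpansive_diagonal:
  assumes "\<And>x. cmod (d x) = 1"
  shows "nonexpansive N (\<lambda>x y. if x = y then d x else 0)"
  unfolding nonexpansive_def
proof
  fix w
  have "(\<Sum>z\<in>{0..<int N}. (if x = z then d x else 0) * w z) = d x * w x" if "x \<in> {0..<int N}" for x
    using that by (simp add: if_distrib[of "\<lambda>u. u * _"] cong: if_cong)
  then show "L2_set (\<lambda>x. cmod (\<Sum>z\<in>{0..<int N}. (if x = z then d x else 0) * w z)) {0..<int N}
     \<le> L2_set (\<lambda>x. cmod (w x)) {0..<int N}"
    using assms by (intro eq_refl L2_set_cong) (simp_all add: norm_mult)
qed

text \<open>An instance of Parseval, which even gives equality of norms.\<close>

lemma nonexpansive_cnj_dft:
  assumes "N > 0"
  shows "nonexpansive N (\<lambda>x y. cnj (dft N x y))"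
  unfolding nonexpansive_def
proof
  fix w
  let ?Z = "{0..<int N}"
  have "(\<Sum>z\<in>?Z. cnj (dft N x z) * w z) = (\<Sum>z\<in>?Z. w z * e_char N (-(x * z))) / of_real (sqrt N)" for x
    by (simp add: dft_def sum_divide_distrib mult.commute)
  then have "(\<Sum>x\<in>?Z. (cmod (\<Sum>z\<in>?Z. cnj (dft N x z) * w z))\<^sup>2)
     = (\<Sum>x\<in>?Z. (cmod (\<Sum>z\<in>?Z. w z * e_char N (-(x * z))))\<^sup>2) / real N"
    by (simp add: norm_divide power_divide flip: sum_divide_distrib)
  also have "\<dots> = (\<Sum>x\<in>?Z. (cmod (w x))\<^sup>2)"
    using fourier_parseval[OF assms, of w 0] assms by simp
  finally show "L2_set (\<lambda>x. cmod (\<Sum>z\<in>?Z. cnj (dft N x z) * w z)) ?Z \<le> L2_set (\<lambda>x. cmod (w x)) ?Z"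
    by (simp add: L2_set_def)
qed

text \<open>Left multiplication acts on each column separately.\<close>

lemma hs_int_mult_left_le:
  assumes "nonexpansive N V"
  shows "hs_int N (\<lambda>x y. \<Sum>z\<in>{0..<int N}. V x z * b z y) \<le> hs_int N b"
proof -
  let ?Z = "{0..<int N}"
  have "(\<Sum>x\<in>?Z. (cmod (\<Sum>z\<in>?Z. V x z * b z y))\<^sup>2) \<le> (\<Sum>x\<in>?Z. (cmod (b x y))\<^sup>2)" for y
    using assms[unfolded nonexpansive_def, rule_format, of "\<lambda>z. b z y"] by (simp add: L2_set_def)
  then have "(\<Sum>y\<in>?Z. \<Sum>x\<in>?Z. (cmod (\<Sum>z\<in>?Z. V x z * b z y))\<^sup>2) \<le> (\<Sum>y\<in>?Z. \<Sum>x\<in>?Z. (cmod (b x y))\<^sup>2)"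
    by (rule sum_mono)
  then have "(\<Sum>x\<in>?Z. \<Sum>y\<in>?Z. (cmod (\<Sum>z\<in>?Z. V x z * b z y))\<^sup>2) \<le> (\<Sum>x\<in>?Z. \<Sum>y\<in>?Z. (cmod (b x y))\<^sup>2)"
    by (subst (1 2) sum.swap)
  then show ?thesis
    by (simp add: hs_int_def L2_set_def case_prod_unfold sum.cartesian_product)
qed

lemma hs_int_mult_right_le:
  assumes "nonexpansive N (\<lambda>x y. V y x)"
  shows "hs_int N (\<lambda>x y. \<Sum>z\<in>{0..<int N}. b x z * V z y) \<le> hs_int N b"
  using hs_int_mult_left_le[OF assms, of "\<lambda>x y. b y x"]
  by (subst hs_int_transpose[symmetric]) (simp add: hs_int_transpose[of N b] mult.commute)

text \<open>The graph on four blocks has the triangles 0-1-2 and 0-1-3; all edges but 1-2 and 1-3 carry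
  the identity, so the holonomies around the triangles are the shear and the rotation.\<close>

definition link :: "nat \<Rightarrow> nat \<Rightarrow> nat \<Rightarrow> int \<Rightarrow> int \<Rightarrow> complex" where
  "link N i j x y =
    (if i = 0 \<and> j \<noteq> 0 \<or> i \<noteq> 0 \<and> j = 0 then (if x = y then 1 else 0)
     else if i = 1 \<and> j = 2 then (if x = y then quad_phase N x else 0)
     else if i = 2 \<and> j = 1 then (if x = y then cnj (quad_phase N x) else 0)
     else if i = 1 \<and> j = 3 then dft N x y
     else if i = 3 \<and> j = 1 then cnj (dft N x y)
     else 0)"

lemma dft_sym: "dft N x y = dft N y x"
  by (simp add: dft_def mult.commute)

text \<open>Reversing an edge takes the adjoint of its block; this makes \<open>Y\<close>
  Hermitian.\<close>

lemma cnj_link: "cnj (link N i j x y) = link N j i y x"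
  by (auto simp: link_def dft_sym)

lemma nonexpansive_link:
  assumes "N > 0"
  shows "nonexpansive N (link N i j)"
proof -
  consider "i = 0 \<and> j \<noteq> 0 \<or> i \<noteq> 0 \<and> j = 0" | "i = 1" "j = 2" | "i = 2" "j = 1" | "i = 1" "j = 3"
    | "i = 3" "j = 1"
    | "\<not> (i = 0 \<and> j \<noteq> 0 \<or> i \<noteq> 0 \<and> j = 0)" "\<not> (i = 1 \<and> j = 2)" "\<not> (i = 2 \<and> j = 1)"
      "\<not> (i = 1 \<and> j = 3)" "\<not> (i = 3 \<and> j = 1)"
    by blast
  then show ?thesis
  proof cases
    case 1
    then show ?thesis using nonexpansive_diagonal[of "\<lambda>_. 1" N] by (auto simp: link_def[abs_def])
  next
    case 2
    then show ?thesis using nonexpansive_diagonal[of "quad_phase N" N] by (simp add: link_def[abs_def])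
  next
    case 3
    then show ?thesis using nonexpansive_diagonal[of "\<lambda>x. cnj (quad_phase N x)" N] by (simp add: link_def[abs_def])
  next
    case 4
    then show ?thesis using nonexpansive_cnj[OF nonexpansive_cnj_dft[OF assms]] by (simp add: link_def[abs_def])
  next
    case 5
    then show ?thesis using nonexpansive_cnj_dft[OF assms] by (simp add: link_def[abs_def])
  next
    case 6
    then have "link N i j = (\<lambda>x y. 0)"
      unfolding link_def[abs_def] by (simp only: if_False)
    then show ?thesis by (simp add: nonexpansive_def L2_set_def sum_nonneg)
  qed
qed

lemma nonexpansive_link_transpose:
  assumes "N > 0"
  shows "nonexpansive N (\<lambda>x y. link N i j y x)"
  using nonexpansive_cnj[OF nonexpansive_link[OF assms, of j i]] by (simp add: cnj_link)

section \<open>Cutting a matrix of size \<open>4 * N\<close> into blocks\<close>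

lemma sum_blocks:
  assumes "N > 0"
  shows "(\<Sum>t<r * N. h t) = (\<Sum>i<r. \<Sum>x\<in>{0..<int N}. h (i * N + nat x))"
proof -
  have shift: "(\<Sum>t\<in>{c..<c + N}. h t) = (\<Sum>x\<in>{0..<int N}. h (c + nat x))" for c
    by (rule sum.reindex_bij_witness[where j = "\<lambda>t. int (t - c)" and i = "\<lambda>x. c + nat x"])
      (auto simp: nat_diff_distrib)
  have "(\<Sum>t<r * N. h t) = (\<Sum>i<r. \<Sum>t\<in>{i * N..<i * N + N}. h t)"
    by (rule sum.nat_group[symmetric])
  also have "\<dots> = (\<Sum>i<r. \<Sum>x\<in>{0..<int N}. h (i * N + nat x))"
    by (simp only: shift)
  finally show ?thesis .
qed

definition hs_nat :: "nat \<Rightarrow> (nat \<Rightarrow> nat \<Rightarrow> complex) \<Rightarrow> real" where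
  "hs_nat n M = L2_set (\<lambda>(s,t). cmod (M s t)) ({..<n} \<times> {..<n})"

text \<open>The reduction modulo \<open>N\<close> extends the block to a biperiodic function, as the
  Weyl calculus expects.\<close>

definition blk :: "nat \<Rightarrow> (nat \<Rightarrow> nat \<Rightarrow> complex) \<Rightarrow> nat \<Rightarrow> nat \<Rightarrow> int \<Rightarrow> int \<Rightarrow> complex" where
  "blk N M i j x y = M (i * N + nat (x mod int N)) (j * N + nat (y mod int N))"

lemma biperiodic_blk: "biperiodic N (blk N M i j)"
  by (simp add: biperiodic_def blk_def)

lemma hs_nat_sq_blk:
  assumes "N > 0"
  shows "(hs_nat (4 * N) M)\<^sup>2 = (\<Sum>(i,j)\<in>{..<4} \<times> {..<4}. (hs_int N (blk N M i j))\<^sup>2)"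
proof -
  let ?Z = "{0..<int N}"
  have "(hs_nat (4 * N) M)\<^sup>2 = (\<Sum>s<4 * N. \<Sum>t<4 * N. (cmod (M s t))\<^sup>2)"
    by (simp add: hs_nat_def L2_set_def case_prod_unfold sum_nonneg sum.cartesian_product)
  also have "\<dots> = (\<Sum>i<4. \<Sum>x\<in>?Z. \<Sum>j<4. \<Sum>y\<in>?Z. (cmod (M (i * N + nat x) (j * N + nat y)))\<^sup>2)"
    by (simp only: sum_blocks[OF assms])
  also have "\<dots> = (\<Sum>i<4. \<Sum>j<4. \<Sum>x\<in>?Z. \<Sum>y\<in>?Z. (cmod (M (i * N + nat x) (j * N + nat y)))\<^sup>2)"
    by (intro sum.cong refl sum.swap)
  also have "\<dots> = (\<Sum>i<4. \<Sum>j<4. (hs_int N (blk N M i j))\<^sup>2)"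
    by (simp add: hs_int_sq blk_def)
  finally show ?thesis by (simp add: sum.cartesian_product)
qed

lemma hs_int_blk_le_hs_nat:
  assumes "N > 0" "i < 4" "j < 4"
  shows "hs_int N (blk N M i j) \<le> hs_nat (4 * N) M"
proof (rule power2_le_imp_le)
  show "(hs_int N (blk N M i j))\<^sup>2 \<le> (hs_nat (4 * N) M)\<^sup>2"
    unfolding hs_nat_sq_blk[OF assms(1)]
    using member_le_sum[of "(i,j)" "{..<4} \<times> {..<4}" "\<lambda>(i,j). (hs_int N (blk N M i j))\<^sup>2"] assms
    by auto
qed (simp add: hs_nat_def)

lemma hs_nat_le_sum_blk:
  assumes "N > 0"
  shows "hs_nat (4 * N) M \<le> (\<Sum>i<4. \<Sum>j<4. hs_int N (blk N M i j))"
proof -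
  have "hs_nat (4 * N) M = L2_set (\<lambda>(i,j). hs_int N (blk N M i j)) ({..<4} \<times> {..<4})"
    using hs_nat_sq_blk[OF assms, of M] unfolding L2_set_def
    by (simp add: case_prod_unfold hs_nat_def flip: real_sqrt_unique)
  also have "\<dots> \<le> (\<Sum>(i,j)\<in>{..<4} \<times> {..<4}. hs_int N (blk N M i j))"
    by (rule L2_set_le_sum) auto
  finally show ?thesis by (simp add: sum.cartesian_product)
qed

section \<open>The Hermitian parts \<open>X\<close> and \<open>Y\<close> and their joint gap\<close>

text \<open>The diagonal of \<open>X\<close>. Block \<open>i\<close> has values from
  \<open>2 * i\<close> up to less than \<open>2 * i + 1\<close>, so distinct blocks are separated by
  at least 1, while \<open>x / N\<close> is the clock inside a block.\<close>

definition band :: "nat \<Rightarrow> nat \<Rightarrow> real" where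
  "band N t = 2 * real (t div N) + real (t mod N) / real N"

definition coupling :: "nat \<Rightarrow> nat \<Rightarrow> nat \<Rightarrow> complex" where
  "coupling N s t = link N (s div N) (t div N) (int (s mod N)) (int (t mod N))"

lemma cnj_coupling: "cnj (coupling N s t) = coupling N t s"
  by (simp add: coupling_def cnj_link)

lemma block_index:
  assumes "x \<in> {0..<int N}"
  shows "(i * N + nat x) div N = i" "int ((i * N + nat x) mod N) = x" "(i * N + nat x) mod N = nat x"
proof -
  have "nat x < N" using assms by auto
  then show "(i * N + nat x) div N = i" "int ((i * N + nat x) mod N) = x" "(i * N + nat x) mod N = nat x"
    using assms by auto
qed

lemma coupling_block:
  assumes "x \<in> {0..<int N}" "y \<in> {0..<int N}"
  shows "coupling N (i * N + nat x) (j * N + nat y) = link N i j x y"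
  unfolding coupling_def block_index(1,2)[OF assms(1)] block_index(1,2)[OF assms(2)] ..

definition comm_fun :: "nat \<Rightarrow> (nat \<Rightarrow> nat \<Rightarrow> complex) \<Rightarrow> (nat \<Rightarrow> nat \<Rightarrow> complex) \<Rightarrow> nat \<Rightarrow> nat \<Rightarrow> complex" where
  "comm_fun n A B s t = (\<Sum>u<n. A s u * B u t) - (\<Sum>u<n. B s u * A u t)"

lemma blk_comm_coupling:
  assumes "N > 0" "x \<in> {0..<int N}" "y \<in> {0..<int N}"
  shows "blk N (comm_fun (4 * N) (coupling N) B) i j x y =
     (\<Sum>k<4. \<Sum>z\<in>{0..<int N}. link N i k x z * blk N B k j z y)
     - (\<Sum>k<4. \<Sum>z\<in>{0..<int N}. blk N B i k x z * link N k j z y)"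
  using assms(2,3) by (simp add: blk_def comm_fun_def sum_blocks[OF assms(1)] coupling_block)

text \<open>The \<open>band\<close> commutator makes off-diagonal blocks small and supplies the
  clock; the \<open>coupling\<close> commutator then relates the diagonal blocks, and
  \<open>weyl_gap\<close> bounds block 1.\<close>

lemma spectral_gap:
  fixes B :: "nat \<Rightarrow> nat \<Rightarrow> complex"
  assumes N: "int N = 4 * k + 1" "k \<ge> 0"
    and tr: "(\<Sum>s<4 * N. B s s) = 0"
    and X: "hs_nat (4 * N) (\<lambda>s t. of_real (band N s - band N t) * B s t) \<le> \<eta>"
    and Y: "hs_nat (4 * N) (comm_fun (4 * N) (coupling N) B) \<le> \<eta>"
  shows "hs_nat (4 * N) B \<le> 5000 * \<eta>"
proof -
  have N0: "N > 0" using N by (cases N) auto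
  let ?Z = "{0..<int N}"
  define b where "b = blk N B"
  have hX: "hs_int N (blk N (\<lambda>s t. of_real (band N s - band N t) * B s t) i j) \<le> \<eta>" if "i < 4" "j < 4" for i j
    using hs_int_blk_le_hs_nat[OF N0 that] X order_trans by blast
  have band: "band N (i * N + nat x) = 2 * real i + real_of_int x / real N" if "x \<in> ?Z" for i x
    unfolding band_def block_index(1,3)[OF that] using that by simp
  have clock: "hs_int N (\<lambda>x y. of_real ((real_of_int x - real_of_int y) / real N) * b i i x y) \<le> \<eta>" if "i < 4" for i
  proof -
    have "hs_int N (\<lambda>x y. of_real ((real_of_int x - real_of_int y) / real N) * b i i x y)
       = hs_int N (blk N (\<lambda>s t. of_real (band N s - band N t) * B s t) i i)"
      by (rule hs_int_cong) (simp add: blk_def b_def band diff_divide_distrib)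
    then show ?thesis using hX[OF that that] by simp
  qed
  have off: "hs_int N (b i j) \<le> \<eta>" if "i < 4" "j < 4" "i \<noteq> j" for i j
  proof -
    have "hs_int N (b i j) \<le> hs_int N (blk N (\<lambda>s t. of_real (band N s - band N t) * B s t) i j)"
    proof (rule hs_int_mono)
      fix x y assume xy: "x \<in> ?Z" "y \<in> ?Z"
      have "\<bar>real i - real j\<bar> \<ge> 1" using that(3) by linarith
      moreover have "0 \<le> real_of_int x / real N" "real_of_int x / real N \<le> 1" if "x \<in> ?Z" for x
        using that N0 by (auto simp: divide_le_eq)
      moreover note this(1)[OF xy(1)] this(1)[OF xy(2)] this(2)[OF xy(1)] this(2)[OF xy(2)]
      ultimately have "1 \<le> \<bar>band N (i * N + nat x) - band N (j * N + nat y)\<bar>"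
        unfolding band[OF xy(1)] band[OF xy(2)] by linarith
      from mult_right_mono[OF this, of "cmod (b i j x y)"]
      show "cmod (b i j x y) \<le> cmod (blk N (\<lambda>s t. of_real (band N s - band N t) * B s t) i j x y)"
        using xy by (simp add: blk_def b_def norm_mult flip: of_real_diff)
    qed
    then show ?thesis using hX[OF that(1,2)] by simp
  qed
  have e0: "\<eta> \<ge> 0" using off[of 0 1] hs_int_nonneg[of N "b 0 1"] by linarith
  \<comment> \<open>In block \<open>(i, j)\<close> of the commutator the terms \<open>k = j\<close>
    and \<open>k = i\<close> contain diagonal blocks of \<open>B\<close>. The other six contain
    off-diagonal ones and cost \<open>\<eta>\<close> each, and the commutator itself costs one
    more.\<close>
  have diag: "hs_int N (\<lambda>x y. (\<Sum>z\<in>?Z. link N i j x z * b j j z y) - (\<Sum>z\<in>?Z. b i i x z * link N i j z y)) \<le> 7 * \<eta>"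
    if ij: "i < 4" "j < 4" for i j
  proof -
    define C where "C = blk N (comm_fun (4 * N) (coupling N) B) i j"
    define L where "L k x y = (\<Sum>z\<in>?Z. link N i k x z * b k j z y)" for k x y
    define M where "M k x y = (\<Sum>z\<in>?Z. b i k x z * link N k j z y)" for k x y
    have "hs_int N C \<le> \<eta>"
      unfolding C_def using hs_int_blk_le_hs_nat[OF N0 ij] Y order_trans by blast
    moreover have "hs_int N (\<lambda>x y. \<Sum>k\<in>{..<4} - {j}. L k x y) \<le> 3 * \<eta>"
    proof -
      have "hs_int N (L k) \<le> \<eta>" if "k \<in> {..<4} - {j}" for k
        unfolding L_def using order_trans[OF hs_int_mult_left_le[OF nonexpansive_link[OF N0]] off[of k j]] that ij by simp
      then have "(\<Sum>k\<in>{..<4} - {j}. hs_int N (L k)) \<le> of_nat (card ({..<4} - {j})) * \<eta>"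
        by (rule sum_bounded_above)
      also have "card ({..<4} - {j}) = 3" using ij by simp
      finally show ?thesis using hs_int_sum[of N L "{..<4} - {j}"] by simp
    qed
    moreover have "hs_int N (\<lambda>x y. \<Sum>k\<in>{..<4} - {i}. M k x y) \<le> 3 * \<eta>"
    proof -
      have "hs_int N (M k) \<le> \<eta>" if "k \<in> {..<4} - {i}" for k
        unfolding M_def using order_trans[OF hs_int_mult_right_le[OF nonexpansive_link_transpose[OF N0]] off[of i k]] that ij by simp
      then have "(\<Sum>k\<in>{..<4} - {i}. hs_int N (M k)) \<le> of_nat (card ({..<4} - {i})) * \<eta>"
        by (rule sum_bounded_above)
      also have "card ({..<4} - {i}) = 3" using ij by simp
      finally show ?thesis using hs_int_sum[of N M "{..<4} - {i}"] by simp
    qed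
    moreover have "hs_int N (\<lambda>x y. L j x y - M i x y)
      = hs_int N (\<lambda>x y. (C x y - (\<Sum>k\<in>{..<4} - {j}. L k x y)) + (\<Sum>k\<in>{..<4} - {i}. M k x y))"
    proof (rule hs_int_cong)
      fix x y assume "x \<in> ?Z" "y \<in> ?Z"
      then have "C x y = (\<Sum>k<4. L k x y) - (\<Sum>k<4. M k x y)"
        unfolding C_def L_def M_def b_def by (rule blk_comm_coupling[OF N0])
      moreover have "(\<Sum>k<4. L k x y) = L j x y + (\<Sum>k\<in>{..<4} - {j}. L k x y)"
        "(\<Sum>k<4. M k x y) = M i x y + (\<Sum>k\<in>{..<4} - {i}. M k x y)"
        using ij by (auto intro!: sum.remove)
      ultimately show "L j x y - M i x y = (C x y - (\<Sum>k\<in>{..<4} - {j}. L k x y)) + (\<Sum>k\<in>{..<4} - {i}. M k x y)"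
        by simp
    qed
    moreover have "\<dots> \<le> (hs_int N C + hs_int N (\<lambda>x y. \<Sum>k\<in>{..<4} - {j}. L k x y)) + hs_int N (\<lambda>x y. \<Sum>k\<in>{..<4} - {i}. M k x y)"
      by (intro order_trans[OF hs_int_triangle] add_right_mono hs_int_triangle_diff)
    ultimately show ?thesis unfolding L_def M_def by linarith
  qed
  have id: "hs_int N (\<lambda>x y. b j j x y - b i i x y) \<le> 7 * \<eta>" if "i < 4" "j < 4" "i = 0 \<and> j \<noteq> 0 \<or> i \<noteq> 0 \<and> j = 0" for i j
  proof -
    have "hs_int N (\<lambda>x y. b j j x y - b i i x y)
      = hs_int N (\<lambda>x y. (\<Sum>z\<in>?Z. link N i j x z * b j j z y) - (\<Sum>z\<in>?Z. b i i x z * link N i j z y))"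
    proof (rule hs_int_cong)
      have l: "link N i j x y = (if x = y then 1 else 0)" for x y using that(3) by (simp add: link_def)
      fix x y assume "x \<in> ?Z" "y \<in> ?Z"
      then show "b j j x y - b i i x y = (\<Sum>z\<in>?Z. link N i j x z * b j j z y) - (\<Sum>z\<in>?Z. b i i x z * link N i j z y)"
        by (simp add: l if_distrib[of "\<lambda>u. u * _"] if_distrib[of "\<lambda>u. _ * u"] cong: if_cong)
    qed
    then show ?thesis using diag[OF that(1,2)] by simp
  qed
  have step: "hs_int N f \<le> hs_int N g + hs_int N (\<lambda>x y. f x y - g x y)" for f g
    using hs_int_triangle[of N g "\<lambda>x y. f x y - g x y"] by simp
  \<comment> \<open>Blocks 2 and 3 are compared with block 1 through block 0, where all edges carry
    the identity.\<close>
  have two: "hs_int N (\<lambda>x y. b 1 1 x y - b j j x y) \<le> 2 * (7 * \<eta>)" if "j = 2 \<or> j = 3" for j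
    using hs_int_triangle[of N "\<lambda>x y. b 1 1 x y - b 0 0 x y" "\<lambda>x y. b 0 0 x y - b j j x y"] id[of 0 1] id[of j 0] that
    by auto
  have b1: "hs_int N (b 1 1) \<le> 174 * (7 * \<eta>)"
  proof (rule weyl_gap[OF N, of "b 0 0" "b 1 1" "b 2 2" "b 3 3"])
    have "(\<Sum>s<4 * N. B s s) = (\<Sum>i<4. \<Sum>x\<in>?Z. b i i x x)"
      by (simp add: sum_blocks[OF N0] b_def blk_def)
    then show "(\<Sum>x\<in>?Z. b 0 0 x x) + (\<Sum>x\<in>?Z. b 1 1 x x) + (\<Sum>x\<in>?Z. b 2 2 x x) + (\<Sum>x\<in>?Z. b 3 3 x x) = 0"
      using tr by (simp add: eval_nat_numeral)
    show "hs_int N (\<lambda>x y. of_real ((real_of_int x - real_of_int y) / real N) * b 1 1 x y) \<le> 7 * \<eta>"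
      using clock[of 1] e0 by simp
    show "hs_int N (\<lambda>x y. b 1 1 x y - b 0 0 x y) \<le> 7 * \<eta>" using id[of 0 1] by simp
    have "hs_int N (\<lambda>x y. quad_phase N x * b 2 2 x y - b 1 1 x y * quad_phase N y)
      = hs_int N (\<lambda>x y. (\<Sum>z\<in>?Z. link N 1 2 x z * b 2 2 z y) - (\<Sum>z\<in>?Z. b 1 1 x z * link N 1 2 z y))"
    proof (rule hs_int_cong)
      fix x y assume "x \<in> ?Z" "y \<in> ?Z"
      then show "quad_phase N x * b 2 2 x y - b 1 1 x y * quad_phase N y
        = (\<Sum>z\<in>?Z. link N 1 2 x z * b 2 2 z y) - (\<Sum>z\<in>?Z. b 1 1 x z * link N 1 2 z y)"
        by (simp add: link_def if_distrib[of "\<lambda>u. u * _"] if_distrib[of "\<lambda>u. _ * u"] cong: if_cong)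
    qed
    then show "hs_int N (\<lambda>x y. quad_phase N x * b 2 2 x y - b 1 1 x y * quad_phase N y) \<le> 7 * \<eta>"
      using diag[of 1 2] by simp
    show "hs_int N (\<lambda>x y. (\<Sum>z\<in>?Z. dft N x z * b 3 3 z y) - (\<Sum>z\<in>?Z. b 1 1 x z * dft N z y)) \<le> 7 * \<eta>"
      using diag[of 1 3] by (simp add: link_def)
  qed (use two in \<open>simp_all add: b_def biperiodic_blk\<close>)
  \<comment> \<open>\<open>1232 = 174 * 7 + 2 * 7\<close>: the bound for block 1 plus the distance
    to it.\<close>
  have "hs_int N (b i i) \<le> 1232 * \<eta>" if i: "i < 4" for i
  proof -
    consider "i = 0" | "i = 1" | "i = 2" | "i = 3" using i by linarith
    then show ?thesis
      using b1 e0 two[of i] id[of 1 0] step[of "b i i" "b 1 1"] hs_int_diff_commute[of N "b 1 1" "b i i"]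
      by cases auto
  qed
  then have "hs_int N (b i j) \<le> (if i = j then 1232 * \<eta> else \<eta>)" if "i < 4" "j < 4" for i j
    using off that by auto
  then have "(\<Sum>i<4. \<Sum>j<4. hs_int N (b i j)) \<le> (\<Sum>i<4::nat. \<Sum>j<4::nat. (if i = j then 1232 * \<eta> else \<eta>))"
    by (intro sum_mono) auto
  \<comment> \<open>Four diagonal and twelve off-diagonal blocks:
    \<open>4 * 1232 + 12\<close>.\<close>
  also have "\<dots> = 4940 * \<eta>" by (simp add: eval_nat_numeral)
  finally show ?thesis using hs_nat_le_sum_blk[OF N0, of B] e0 by (simp add: b_def)
qed



text \<open>All blocks are nonexpansive, so each block row costs at most 4, and summing the four
  rows costs 4 again; the bound is crude but independent of \<open>N\<close>.\<close>

lemma coupling_bound: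
  assumes "N > 0"
  shows "L2_set (\<lambda>s. cmod (\<Sum>t<4 * N. coupling N s t * w t)) {..<4 * N} \<le> 16 * L2_set (\<lambda>t. cmod (w t)) {..<4 * N}"
proof -
  let ?Z = "{0..<int N}"
  let ?w = "L2_set (\<lambda>t. cmod (w t)) {..<4 * N}"
  define wb where "wb u i x = u (i * N + nat x)" for u :: "nat \<Rightarrow> complex" and i x
  have split: "(L2_set (\<lambda>t. cmod (u t)) {..<4 * N})\<^sup>2 = (\<Sum>i<4. (L2_set (\<lambda>x. cmod (wb u i x)) ?Z)\<^sup>2)" for u
    by (simp add: L2_set_def sum_nonneg sum_blocks[OF assms] wb_def)
  have w_le: "L2_set (\<lambda>x. cmod (wb w j x)) ?Z \<le> ?w" if "j < 4" for j
  proof (rule power2_le_imp_le)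
    show "(L2_set (\<lambda>x. cmod (wb w j x)) ?Z)\<^sup>2 \<le> ?w\<^sup>2"
      unfolding split using that by (intro member_le_sum[where f = "\<lambda>j. (L2_set (\<lambda>x. cmod (wb w j x)) ?Z)\<^sup>2"]) auto
  qed simp
  define v where "v s = (\<Sum>t<4 * N. coupling N s t * w t)" for s
  have row: "L2_set (\<lambda>x. cmod (wb v i x)) ?Z \<le> 4 * ?w" for i
  proof -
    have "L2_set (\<lambda>x. cmod (wb v i x)) ?Z = L2_set (\<lambda>x. cmod (\<Sum>j<4. \<Sum>z\<in>?Z. link N i j x z * wb w j z)) ?Z"
      by (rule L2_set_cong) (simp_all add: wb_def v_def sum_blocks[OF assms] coupling_block)
    also have "\<dots> \<le> (\<Sum>j<4. L2_set (\<lambda>x. cmod (\<Sum>z\<in>?Z. link N i j x z * wb w j z)) ?Z)"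
      by (rule L2_set_cmod_sum)
    also have "\<dots> \<le> (\<Sum>j<4. L2_set (\<lambda>x. cmod (wb w j x)) ?Z)"
      using nonexpansive_link[OF assms] unfolding nonexpansive_def by (intro sum_mono) blast
    also have "\<dots> \<le> of_nat (card {..<4::nat}) * ?w"
      using w_le by (intro sum_bounded_above) auto
    finally show ?thesis by simp
  qed
  have "L2_set (\<lambda>s. cmod (v s)) {..<4 * N} = L2_set (\<lambda>i. L2_set (\<lambda>x. cmod (wb v i x)) ?Z) {..<4}"
    using split[of v] by (simp add: L2_set_def[of _ "{..<4}"] flip: real_sqrt_unique)
  also have "\<dots> \<le> (\<Sum>i<4. L2_set (\<lambda>x. cmod (wb v i x)) ?Z)"
    by (rule L2_set_le_sum) simp
  also have "\<dots> \<le> of_nat (card {..<4::nat}) * (4 * ?w)"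
    using row by (intro sum_bounded_above) auto
  finally show ?thesis by (simp add: v_def)
qed

section \<open>From index functions to matrices\<close>

lemma index_mat_adjoint:
  assumes "i < dim_col A" "j < dim_row A"
  shows "mat_adjoint A $$ (i, j) = conjugate (A $$ (j, i))"
  using assms by (simp add: mat_adjoint_def mat_of_rows_index)

lemma dim_mat_adjoint [simp]:
  "dim_row (mat_adjoint A) = dim_col A" "dim_col (mat_adjoint A) = dim_row A"
  by (simp_all add: mat_adjoint_def)

lemma hs_norm_eq_hs_nat:
  assumes "B \<in> carrier_mat n n"
  shows "hs_norm B = hs_nat n (\<lambda>s t. B $$ (s, t))"
proof -
  have "mat_trace (mat_adjoint B * B) = (\<Sum>t<n. \<Sum>s<n. cnj (B $$ (s, t)) * B $$ (s, t))"
    using assms by (simp add: mat_trace_def scalar_prod_def index_mat_adjoint lessThan_atLeast0)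
  also have "\<dots> = (\<Sum>s<n. \<Sum>t<n. cnj (B $$ (s, t)) * B $$ (s, t))"
    by (rule sum.swap)
  also have "\<dots> = complex_of_real (\<Sum>s<n. \<Sum>t<n. (cmod (B $$ (s, t)))\<^sup>2)"
    by (simp add: complex_norm_square mult.commute del: of_real_power)
  finally show ?thesis
    by (simp add: hs_norm_def hs_nat_def L2_set_def case_prod_unfold sum.cartesian_product)
qed

lemma mat_commutator_index:
  assumes "A \<in> carrier_mat n n" "B \<in> carrier_mat n n" "s < n" "t < n"
  shows "mat_commutator A B $$ (s, t) = comm_fun n (\<lambda>s t. A $$ (s, t)) (\<lambda>s t. B $$ (s, t)) s t"
  using assms by (simp add: mat_commutator_def comm_fun_def scalar_prod_def lessThan_atLeast0)

lemma hs_nat_cong: "(\<And>s t. s < n \<Longrightarrow> t < n \<Longrightarrow> f s t = g s t) \<Longrightarrow> hs_nat n f = hs_nat n g"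
  unfolding hs_nat_def by (intro L2_set_cong) auto

lemma hs_nat_cnj_transpose: "hs_nat n (\<lambda>s t. cnj (f t s)) = hs_nat n f"
proof -
  have "(\<Sum>s<n. \<Sum>t<n. (cmod (f t s))\<^sup>2) = (\<Sum>s<n. \<Sum>t<n. (cmod (f s t))\<^sup>2)"
    by (rule sum.swap)
  then show ?thesis
    by (simp add: hs_nat_def L2_set_def case_prod_unfold sum.cartesian_product)
qed

text \<open>For \<open>f\<close> the commutator of \<open>(X + i Y) / 32\<close> with a Hermitian
  matrix, \<open>c = -1\<close> isolates the \<open>X\<close> part and \<open>c = 1\<close> the
  \<open>Y\<close> part. The factor 16 is half of 32.\<close>

lemma hs_nat_combination_le:
  assumes "cmod c = 1"
  shows "hs_nat n (\<lambda>s t. 16 * (f s t + c * cnj (f t s))) \<le> 32 * hs_nat n f"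
proof -
  let ?S = "{..<n} \<times> {..<n}"
  have "hs_nat n (\<lambda>s t. 16 * (f s t + c * cnj (f t s)))
     \<le> L2_set (\<lambda>p. 16 * ((case p of (s,t) \<Rightarrow> cmod (f s t)) + (case p of (s,t) \<Rightarrow> cmod (cnj (f t s))))) ?S"
    unfolding hs_nat_def
  proof (rule L2_set_mono)
    fix p
    show "(case p of (s, t) \<Rightarrow> cmod (16 * (f s t + c * cnj (f t s))))
       \<le> 16 * ((case p of (s,t) \<Rightarrow> cmod (f s t)) + (case p of (s,t) \<Rightarrow> cmod (cnj (f t s))))"
      using assms norm_triangle_ineq[of "f (fst p) (snd p)" "c * cnj (f (snd p) (fst p))"]
      by (simp add: case_prod_unfold norm_mult del: distrib_left_numeral)
  qed auto
  also have "\<dots> = 16 * L2_set (\<lambda>p. (case p of (s,t) \<Rightarrow> cmod (f s t)) + (case p of (s,t) \<Rightarrow> cmod (cnj (f t s)))) ?S"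
    by (simp add: L2_set_right_distrib)
  also have "\<dots> \<le> 16 * (hs_nat n f + hs_nat n (\<lambda>s t. cnj (f t s)))"
    unfolding hs_nat_def by (intro mult_left_mono L2_set_triangle_ineq) simp
  finally show ?thesis by (simp add: hs_nat_cnj_transpose)
qed

text \<open>The real diagonal has norm at most 7 and the coupling at most 16, so division by 32
  yields a contraction.\<close>

definition gap_mat :: "nat \<Rightarrow> complex mat" where
  "gap_mat N = mat (4 * N) (4 * N)
     (\<lambda>(s,t). ((if s = t then of_real (band N s) else 0) + \<i> * coupling N s t) / 32)"

lemma gap_mat_carrier: "gap_mat N \<in> carrier_mat (4 * N) (4 * N)"
  by (simp add: gap_mat_def)

lemma band_bounds:
  assumes "s < 4 * N"
  shows "0 \<le> band N s" "band N s \<le> 7"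
proof -
  have "N > 0" using assms by (cases N) auto
  have "s div N \<le> 3" using assms by (simp add: less_mult_imp_div_less less_Suc_eq_le[symmetric])
  moreover have "real (s mod N) / real N \<le> 1"
    using \<open>N > 0\<close> by (simp add: divide_le_eq less_imp_le)
  ultimately show "band N s \<le> 7" by (simp add: band_def)
qed (simp add: band_def)

lemma contraction_gap_mat:
  assumes "N > 0"
  shows "contraction_mat (gap_mat N)"
  unfolding contraction_mat_def op_norm_mat_def
proof (rule cSUP_least)
  show "{v \<in> carrier_vec (dim_col (gap_mat N)). l2_norm_vec v \<le> 1} \<noteq> {}"
    by (auto simp: l2_norm_vec_altdef intro!: exI[of _ "0\<^sub>v (dim_col (gap_mat N))"])
next
  let ?n = "4 * N"
  fix v assume "v \<in> {v \<in> carrier_vec (dim_col (gap_mat N)). l2_norm_vec v \<le> 1}"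
  then have v: "dim_vec v = ?n" "L2_set (\<lambda>t. cmod (v $ t)) {..<?n} \<le> 1"
    by (auto simp: gap_mat_def l2_norm_vec_altdef L2_set_def)
  define c where "c s = (\<Sum>t<?n. coupling N s t * v $ t)" for s
  have entry: "(gap_mat N *\<^sub>v v) $ s = (of_real (band N s) * v $ s + \<i> * c s) / 32" if "s < ?n" for s
  proof -
    have "(gap_mat N *\<^sub>v v) $ s
      = (\<Sum>t<?n. ((if s = t then of_real (band N s) else 0) + \<i> * coupling N s t) / 32 * v $ t)"
      using that v(1) by (simp add: gap_mat_def scalar_prod_def lessThan_atLeast0)
    also have "\<dots> = (\<Sum>t<?n. ((if s = t then of_real (band N s) * v $ t else 0) + \<i> * (coupling N s t * v $ t)) / 32)"
      by (intro sum.cong refl) (simp add: algebra_simps)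
    also have "\<dots> = ((\<Sum>t<?n. if s = t then of_real (band N s) * v $ t else 0) + \<i> * c s) / 32"
      by (simp add: c_def sum.distrib sum_distrib_left flip: sum_divide_distrib)
    finally show ?thesis using that by simp
  qed
  have "l2_norm_vec (gap_mat N *\<^sub>v v) = L2_set (\<lambda>s. cmod ((gap_mat N *\<^sub>v v) $ s)) {..<?n}"
    by (simp add: l2_norm_vec_altdef L2_set_def gap_mat_def)
  also have "\<dots> \<le> L2_set (\<lambda>s. 1 / 32 * (7 * cmod (v $ s) + cmod (c s))) {..<?n}"
  proof (rule L2_set_mono)
    fix s assume s: "s \<in> {..<?n}"
    then have "cmod (of_real (band N s) * v $ s) \<le> 7 * cmod (v $ s)"
      using band_bounds[of s N] by (simp add: norm_mult mult_right_mono)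
    then show "cmod ((gap_mat N *\<^sub>v v) $ s) \<le> 1 / 32 * (7 * cmod (v $ s) + cmod (c s))"
      using s norm_triangle_ineq[of "of_real (band N s) * v $ s" "\<i> * c s"]
      by (simp add: entry norm_divide norm_mult)
  qed auto
  also have "\<dots> = 1 / 32 * L2_set (\<lambda>s. 7 * cmod (v $ s) + cmod (c s)) {..<?n}"
    by (rule L2_set_right_distrib[symmetric]) simp
  also have "\<dots> \<le> 1 / 32 * (L2_set (\<lambda>s. 7 * cmod (v $ s)) {..<?n} + L2_set (\<lambda>s. cmod (c s)) {..<?n})"
    by (intro mult_left_mono L2_set_triangle_ineq) simp
  also have "L2_set (\<lambda>s. 7 * cmod (v $ s)) {..<?n} = 7 * L2_set (\<lambda>s. cmod (v $ s)) {..<?n}"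
    by (rule L2_set_right_distrib[symmetric]) simp
  also have "L2_set (\<lambda>s. cmod (c s)) {..<?n} \<le> 16 * L2_set (\<lambda>s. cmod (v $ s)) {..<?n}"
    unfolding c_def by (rule coupling_bound[OF assms])
  finally show "l2_norm_vec (gap_mat N *\<^sub>v v) \<le> 1" using v(2) by simp
qed

lemma comm_gap_mat:
  fixes B :: "nat \<Rightarrow> nat \<Rightarrow> complex"
  assumes "s < 4 * N" "t < 4 * N"
  shows "comm_fun (4 * N) (\<lambda>s t. gap_mat N $$ (s, t)) B s t
     = (of_real (band N s - band N t) * B s t + \<i> * comm_fun (4 * N) (coupling N) B s t) / 32"
proof -
  let ?n = "4 * N"
  have "(\<Sum>u<?n. gap_mat N $$ (s, u) * B u t)
      = (\<Sum>u<?n. ((if s = u then of_real (band N s) * B u t else 0) + \<i> * (coupling N s u * B u t)) / 32)"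
    using assms by (intro sum.cong refl) (auto simp: gap_mat_def algebra_simps)
  also have "\<dots> = (of_real (band N s) * B s t + \<i> * (\<Sum>u<?n. coupling N s u * B u t)) / 32"
    using assms by (simp add: sum.distrib sum_distrib_left flip: sum_divide_distrib)
  finally have 1: "(\<Sum>u<?n. gap_mat N $$ (s, u) * B u t) = \<dots>" .
  have "(\<Sum>u<?n. B s u * gap_mat N $$ (u, t))
      = (\<Sum>u<?n. ((if u = t then of_real (band N t) * B s u else 0) + \<i> * (B s u * coupling N u t)) / 32)"
    using assms by (intro sum.cong refl) (auto simp: gap_mat_def algebra_simps)
  also have "\<dots> = (of_real (band N t) * B s t + \<i> * (\<Sum>u<?n. B s u * coupling N u t)) / 32"
    using assms by (simp add: sum.distrib sum_distrib_left flip: sum_divide_distrib)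
  finally have 2: "(\<Sum>u<?n. B s u * gap_mat N $$ (u, t)) = \<dots>" .
  show ?thesis unfolding comm_fun_def 1 2 by (simp add: algebra_simps diff_divide_distrib add_divide_distrib)
qed

text \<open>Commutators of Hermitian matrices are skew-Hermitian, so under the adjoint the
  \<open>X\<close> part of \<open>K\<close> changes sign and the \<open>Y\<close> part, with its
  factor \<open>\<i>\<close>, does not; the two can thus be separated. The constant is
  \<open>5000 * 32\<close>.\<close>

lemma gap_mat_commutator_bound:
  assumes N: "int N = 4 * k + 1" "k \<ge> 0"
    and B: "B \<in> carrier_mat (4 * N) (4 * N)" "self_adjoint_mat B" "mat_trace B = 0"
  shows "hs_norm B \<le> 160000 * hs_norm (mat_commutator (gap_mat N) B)"
proof -
  let ?n = "4 * N"
  define b where "b s t = B $$ (s, t)" for s t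
  define K where "K = comm_fun ?n (\<lambda>s t. gap_mat N $$ (s, t)) b"
  define C where "C = comm_fun ?n (coupling N) b"
  have herm: "cnj (b s t) = b t s" if "s < ?n" "t < ?n" for s t
    using index_mat_adjoint[of t B s] B that by (simp add: b_def self_adjoint_mat_def)
  have C: "cnj (C t s) = - C s t" if "s < ?n" "t < ?n" for s t
    using that by (simp add: C_def comm_fun_def herm cnj_coupling mult.commute cong: sum.cong_simp)
  have K: "K s t = (of_real (band N s - band N t) * b s t + \<i> * C s t) / 32" if "s < ?n" "t < ?n" for s t
    unfolding K_def C_def by (rule comm_gap_mat[OF that])
  have K': "cnj (K t s) = (- (of_real (band N s - band N t) * b s t) + \<i> * C s t) / 32" if "s < ?n" "t < ?n" for s t
    using that by (simp add: K herm C algebra_simps)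
  have "hs_nat ?n (\<lambda>s t. of_real (band N s - band N t) * b s t) = hs_nat ?n (\<lambda>s t. 16 * (K s t + (-1) * cnj (K t s)))"
  proof (rule hs_nat_cong)
    fix s t assume st: "s < ?n" "t < ?n"
    show "of_real (band N s - band N t) * b s t = 16 * (K s t + (-1) * cnj (K t s))"
      unfolding K'[OF st] unfolding K[OF st] by (simp add: field_simps)
  qed
  also have "\<dots> \<le> 32 * hs_nat ?n K"
    by (rule hs_nat_combination_le) simp
  finally have X: "hs_nat ?n (\<lambda>s t. of_real (band N s - band N t) * b s t) \<le> 32 * hs_nat ?n K" .
  have "hs_nat ?n C = hs_nat ?n (\<lambda>s t. \<i> * C s t)" by (simp add: hs_nat_def norm_mult)
  also have "\<dots> = hs_nat ?n (\<lambda>s t. 16 * (K s t + 1 * cnj (K t s)))"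
  proof (rule hs_nat_cong)
    fix s t assume st: "s < ?n" "t < ?n"
    show "\<i> * C s t = 16 * (K s t + 1 * cnj (K t s))"
      unfolding K'[OF st] unfolding K[OF st] by (simp add: field_simps)
  qed
  also have "\<dots> \<le> 32 * hs_nat ?n K"
    by (rule hs_nat_combination_le) simp
  finally have Y: "hs_nat ?n C \<le> 32 * hs_nat ?n K" .
  have "(\<Sum>s<?n. b s s) = 0" using B by (simp add: mat_trace_def b_def)
  from spectral_gap[OF N this X Y[unfolded C_def]]
  have "hs_nat ?n b \<le> 160000 * hs_nat ?n K" by simp
  moreover have "hs_norm B = hs_nat ?n b"
    using hs_norm_eq_hs_nat[OF B(1)] by (simp add: b_def[abs_def])
  moreover have "hs_norm (mat_commutator (gap_mat N) B) = hs_nat ?n K"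
  proof -
    have "mat_commutator (gap_mat N) B \<in> carrier_mat ?n ?n"
      using B(1) gap_mat_carrier[of N] by (auto simp: mat_commutator_def)
    then show ?thesis
      unfolding K_def b_def
      by (subst hs_norm_eq_hs_nat) (auto intro!: hs_nat_cong mat_commutator_index[OF gap_mat_carrier B(1)])
  qed
  ultimately show ?thesis by simp
qed

theorem theorem1p1:
  shows "\<exists>\<gamma>::real. \<gamma> > 0 \<and>
    infinite {n::nat. \<exists>A \<in> carrier_mat n n. contraction_mat A \<and>
      (\<forall>B \<in> carrier_mat n n. self_adjoint_mat B \<longrightarrow> mat_trace B = 0 \<longrightarrow>
        hs_norm B \<le> \<gamma> * hs_norm (mat_commutator A B))}"
proof (intro exI[of _ 160000] conjI)
  let ?S = "{n::nat. \<exists>A \<in> carrier_mat n n. contraction_mat A \<and>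
      (\<forall>B \<in> carrier_mat n n. self_adjoint_mat B \<longrightarrow> mat_trace B = 0 \<longrightarrow>
        hs_norm B \<le> 160000 * hs_norm (mat_commutator A B))}"
  \<comment> \<open>The block size \<open>4 * k + 1\<close> is odd, as the quadratic phase requires,
    and is the number of integers from \<open>-2 * k\<close> to \<open>2 * k\<close>.\<close>
  have "range (\<lambda>k. 4 * (4 * k + 1)) \<subseteq> ?S"
  proof (clarify, intro bexI conjI ballI impI)
    fix k :: nat
    show "gap_mat (4 * k + 1) \<in> carrier_mat (4 * (4 * k + 1)) (4 * (4 * k + 1))"
      by (rule gap_mat_carrier)
    show "contraction_mat (gap_mat (4 * k + 1))"
      by (rule contraction_gap_mat) simp
    fix B assume "B \<in> carrier_mat (4 * (4 * k + 1)) (4 * (4 * k + 1))" "self_adjoint_mat B" "mat_trace B = 0"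
    then show "hs_norm B \<le> 160000 * hs_norm (mat_commutator (gap_mat (4 * k + 1)) B)"
      by (intro gap_mat_commutator_bound[of _ "int k"]) auto
  qed
  moreover have "infinite (range (\<lambda>k::nat. 4 * (4 * k + 1)))"
    by (rule range_inj_infinite) (simp add: inj_on_def)
  ultimately show "infinite ?S" using finite_subset by blast
qed simp

end
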